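(* Let $(E,d)$ be a complete separable geodesic space, $p\geq1$, $J\in\mathbb{N}^*$, let $\mu_1,\dots,\mu_J\in\mathcal{W}_p(E)$ and let $\lambda_1,\dots,\lambda_J>0$ with $\sum_i\lambda_i=1$. Then: (1) there exists $\gamma\in\Gamma(\mu_1,\dots,\mu_J)$ minimizing \[ \hat\gamma\mapsto\int \inf_{x\in E}\sum_{i=1}^J\lambda_i d^p(x_i,x)\,d\hat\gamma(x_1,\dots,x_J) \] over $\hat\gamma\in\Gamma(\mu_1,\dots,\mu_J)$; (2) if $T:E^J\to E$ is a Borel map such that $T(x_1,\dots,x_J)$ minimizes $x\mapsto\sum_{i}\lambda_i d^p(x_i,x)$ for every $(x_1,\dots,x_J)\in E^J$, then for any such minimizing $\gamma$, the measure $\nu=T_\#\gamma$ minimizes $\hat\nu\mapsto\sum_{i=1}^J\lambda_iW_p^p(\mu_i,\hat\nu)$ over $\hat\nu\in\mathcal{W}_p(E)$; (3) if moreover for every $(x_1,\dots,x_J)\in E^J$ the minimizer of $x\mapsto\sum_i\lambda_i d^p(x_i,x)$ is unique (so that $T$ is uniquely determined), then every minimizer $\hat\nu$ of $\hat\nu\mapsto\sum_i\lambda_iW_p^p(\mu_i,\hat\nu)$ is of the form $\hat\nu=T_\#\hat\gamma$ for some $\hat\gamma\in\Gamma(\mu_1,\dots,\mu_J)$ minimizing the functional in (1).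
   Context: A geodesic space is a complete metric space $(E,d)$ in which every two points $x,y$ have a mid-point, i.e. a point $z$ with $d(x,z)=d(z,y)=\tfrac12 d(x,y)$. $\mathcal{W}_p(E)$ is the set of Borel probability measures on $E$ with finite $p$-th moment and $W_p(\mu,\nu)=\big(\inf_{\pi\in\Gamma(\mu,\nu)}\int d^p(x,y)\,d\pi\big)^{1/p}$. $\Gamma(\mu_1,\dots,\mu_J)$ denotes the set of Borel probability measures on $E^J$ whose $i$-th marginal is $\mu_i$ for each $i$. $T_\#\gamma$ denotes the pushforward $\gamma\circ T^{-1}$. *)

theory Defs
  imports "HOL-Probability.Probability"
begin

definition geodesic_space :: "'a::metric_space itself \<Rightarrow> bool" where
  "geodesic_space _ \<longleftrightarrow>
     (\<forall>x y::'a. \<exists>z. dist x z = dist x y / 2 \<and> dist z y = dist x y / 2)"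

definition Wp_space :: "real \<Rightarrow> 'a::metric_space measure set" where
  "Wp_space p = {M. sets M = sets (borel :: 'a measure) \<and> prob_space M \<and>
      (\<exists>x0. (\<integral>\<^sup>+ y. ennreal (dist y x0 powr p) \<partial>M) < \<infinity>)}"

abbreviation EJ :: "nat \<Rightarrow> (nat \<Rightarrow> 'a::topological_space) measure" where
  "EJ J \<equiv> PiM {..<J} (\<lambda>_. borel)"
  
definition couplings :: "nat \<Rightarrow> (nat \<Rightarrow> 'a::topological_space measure) \<Rightarrow> (nat \<Rightarrow> 'a) measure set" where
  "couplings J \<mu> = {\<gamma>. sets \<gamma> = sets (EJ J) \<and> prob_space \<gamma> \<and>
      (\<forall>i<J. distr \<gamma> borel (\<lambda>x. x i) = \<mu> i)}"

definition couplings2 :: "'a::topological_space measure \<Rightarrow> 'a measure \<Rightarrow> ('a \<times> 'a) measure set" where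
  "couplings2 \<mu> \<nu> = {\<pi>. sets \<pi> = sets (borel :: ('a \<times> 'a) measure) \<and> prob_space \<pi> \<and>
      distr \<pi> borel fst = \<mu> \<and> distr \<pi> borel snd = \<nu>}"

definition Wpp :: "real \<Rightarrow> 'a::metric_space measure \<Rightarrow> 'a measure \<Rightarrow> ennreal" where
  "Wpp p \<mu> \<nu> = (INF \<pi>\<in>couplings2 \<mu> \<nu>. \<integral>\<^sup>+ z. ennreal (dist (fst z) (snd z) powr p) \<partial>\<pi>)"

definition bary_cost :: "nat \<Rightarrow> real \<Rightarrow> (nat \<Rightarrow> real) \<Rightarrow> (nat \<Rightarrow> 'a::metric_space) \<Rightarrow> real" where
  "bary_cost J p lam xs = (INF x. \<Sum>i<J. lam i * dist (xs i) x powr p)"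

definition MM_cost :: "nat \<Rightarrow> real \<Rightarrow> (nat \<Rightarrow> real) \<Rightarrow> (nat \<Rightarrow> 'a::metric_space) measure \<Rightarrow> ennreal" where
  "MM_cost J p lam \<gamma> = (\<integral>\<^sup>+ xs. ennreal (bary_cost J p lam xs) \<partial>\<gamma>)"

definition is_MM_minimizer ::
  "nat \<Rightarrow> real \<Rightarrow> (nat \<Rightarrow> real) \<Rightarrow> (nat \<Rightarrow> 'a::metric_space measure) \<Rightarrow> (nat \<Rightarrow> 'a) measure \<Rightarrow> bool" where
  "is_MM_minimizer J p lam \<mu> \<gamma> \<longleftrightarrow> \<gamma> \<in> couplings J \<mu> \<and>
     (\<forall>\<gamma>'\<in>couplings J \<mu>. MM_cost J p lam \<gamma> \<le> MM_cost J p lam \<gamma>')"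

definition bary_fun :: "nat \<Rightarrow> real \<Rightarrow> (nat \<Rightarrow> real) \<Rightarrow> (nat \<Rightarrow> 'a::metric_space measure) \<Rightarrow> 'a measure \<Rightarrow> ennreal" where
  "bary_fun J p lam \<mu> \<nu> = (\<Sum>i<J. ennreal (lam i) * Wpp p (\<mu> i) \<nu>)"

definition is_barycenter ::
  "nat \<Rightarrow> real \<Rightarrow> (nat \<Rightarrow> real) \<Rightarrow> (nat \<Rightarrow> 'a::metric_space measure) \<Rightarrow> 'a measure \<Rightarrow> bool" where
  "is_barycenter J p lam \<mu> \<nu> \<longleftrightarrow> \<nu> \<in> Wp_space p \<and>
     (\<forall>\<nu>'\<in>Wp_space p. bary_fun J p lam \<mu> \<nu> \<le> bary_fun J p lam \<mu> \<nu>')"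

definition is_pointwise_bary :: "nat \<Rightarrow> real \<Rightarrow> (nat \<Rightarrow> real) \<Rightarrow> (nat \<Rightarrow> 'a::metric_space) \<Rightarrow> 'a \<Rightarrow> bool" where
  "is_pointwise_bary J p lam xs y \<longleftrightarrow>
     (\<forall>x. (\<Sum>i<J. lam i * dist (xs i) y powr p) \<le> (\<Sum>i<J. lam i * dist (xs i) x powr p))"

end

(*
The multi-marginal problem has a minimizer because couplings with prescribed marginals are
sequentially compact. Each point of E is coded measurably by countably many binary digits (is it
within 1/(n+1) of the k-th point of a dense sequence?) and completeness yields a measurable decoder.
Along a subsequence all finite-dimensional digit probabilities of a sequence of couplings converge;
Kolmogorov's theorem turns the limits into a measure on digit sequences, which is decoded to a
coupling. A nonnegative lower semicontinuous cost is a countable supremum of multiples of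
indicators of digit events, so its integral is lower semicontinuous along the subsequence.

For the barycenters, (x_i, T x) couples mu_i with the push-forward of gamma under T, so the value
at this push-forward is at most the multi-marginal cost of gamma. Conversely, almost optimal couplings
of the mu_i with nu glue approximately to a measure on E^(J+1) of almost the same cost, whose
projection to E^J competes in the multi-marginal problem. Lower semicontinuity on E^(J+1) gives an
exact gluing; if nu is a barycenter, its last coordinate minimizes the pointwise cost almost
everywhere and so equals T by uniqueness.
*)
theory Submission
  imports Defs
begin

section \<open>Limits of binary digit distributions\<close>

text \<open>Two obstacles shape the proof. First, ball events need not be continuity sets of a weak
  limit, and weak limits may lose mass. Neither matters here, because the marginals are fixed: the
  digits of one coordinate have the same law along the whole sequence, so their limit law is again
  carried by codes of points, and the joint digit probabilities of the decoded coupling are exactly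
  the limits.

  Second, the costs are p-th powers, so that an error e in a distance is not a bounded additive
  error in the cost. Convexity gives (a + e)^p \<le> (1 - s)^(1 - p) * a^p + s^(1 - p) * e^p for 0 <
  s < 1. The first factor tends to 1 as s tends to 0, and for fixed s the second term tends to 0
  with e. This inequality is behind the lower semicontinuity of both costs, the near optimality of
  the gluing and the moment bounds.\<close>

definition digit_cylinder :: "'w measure \<Rightarrow> ('i \<Rightarrow> 'w \<Rightarrow> bool) \<Rightarrow> 'i set \<Rightarrow> 'i set \<Rightarrow> 'w set" where
  "digit_cylinder M D F S = {w \<in> space M. \<forall>d\<in>F. D d w \<longleftrightarrow> d \<in> S}"

lemma sets_digit_cylinder:
  assumes "finite F" and [measurable]: "\<And>d. Measurable.pred M (D d)"
  shows "digit_cylinder M D F S \<in> sets M"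
  using \<open>finite F\<close> unfolding digit_cylinder_def by measurable

text \<open>For \<open>S\<close> in \<open>Pow F\<close> the cylinders are the atoms of the algebra
  generated by the digits in \<open>F\<close>, and the integrand is constant on each of them.
  Convergence of such integrals thus reduces to convergence of finitely many probabilities.\<close>

lemma nn_integral_finite_digits:
  fixes h :: "('i \<Rightarrow> bool) \<Rightarrow> ennreal"
  assumes F: "finite F" and D: "\<And>d. Measurable.pred M (D d)"
    and h: "\<And>a b. (\<And>d. d \<in> F \<Longrightarrow> a d = b d) \<Longrightarrow> h a = h b"
  shows "(\<integral>\<^sup>+w. h (\<lambda>d. D d w) \<partial>M) =
    (\<Sum>S\<in>Pow F. h (\<lambda>d. d \<in> S) * emeasure M (digit_cylinder M D F S))"
proof -
  have "(\<integral>\<^sup>+w. h (\<lambda>d. D d w) \<partial>M) =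
      (\<integral>\<^sup>+w. (\<Sum>S\<in>Pow F. h (\<lambda>d. d \<in> S) * indicator (digit_cylinder M D F S) w) \<partial>M)"
  proof (rule nn_integral_cong)
    fix w assume w: "w \<in> space M"
    define S0 where "S0 = {d\<in>F. D d w}"
    have *: "indicator (digit_cylinder M D F S) w = (if S = S0 then 1 else 0 :: ennreal)" if "S \<in> Pow F" for S
      using that w by (auto simp: indicator_def digit_cylinder_def S0_def)
    have "(\<Sum>S\<in>Pow F. h (\<lambda>d. d \<in> S) * indicator (digit_cylinder M D F S) w)
        = (\<Sum>S\<in>Pow F. if S = S0 then h (\<lambda>d. d \<in> S0) else 0)"
      by (intro sum.cong) (auto simp: *)
    also have "\<dots> = h (\<lambda>d. d \<in> S0)"
      using F by (subst sum.delta) (auto simp: S0_def)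
    also have "\<dots> = h (\<lambda>d. D d w)"
      by (rule h) (auto simp: S0_def)
    finally show "h (\<lambda>d. D d w) = (\<Sum>S\<in>Pow F. h (\<lambda>d. d \<in> S) * indicator (digit_cylinder M D F S) w)" ..
  qed
  also have "\<dots> = (\<Sum>S\<in>Pow F. \<integral>\<^sup>+w. h (\<lambda>d. d \<in> S) * indicator (digit_cylinder M D F S) w \<partial>M)"
    using sets_digit_cylinder[OF F D] by (intro nn_integral_sum) auto
  also have "\<dots> = (\<Sum>S\<in>Pow F. h (\<lambda>d. d \<in> S) * emeasure M (digit_cylinder M D F S))"
    using sets_digit_cylinder[OF F D] by (intro sum.cong) (auto simp: nn_integral_cmult_indicator)
  finally show ?thesis .
qed

text \<open>The cube is compact by Tychonoff; countability of the index type makes the product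
  topology first countable, so that compactness yields convergent subsequences.\<close>

lemma convergent_subsequence_unit_interval:
  fixes v :: "nat \<Rightarrow> 'i::countable \<Rightarrow> real"
  assumes "\<And>n i. v n i \<in> {0..1}"
  obtains r l where "strict_mono r" "\<And>i. (\<lambda>n. v (r n) i) \<longlonglongrightarrow> l i"
proof -
  define X :: "('i \<Rightarrow> real) set" where "X = PiE UNIV (\<lambda>_. {0..1})"
  have "compact X"
    unfolding X_def using compactin_PiE[of "\<lambda>_. euclidean" UNIV "\<lambda>_::'i. {0..1::real}"]
    by (simp add: euclidean_product_topology)
  then have "seq_compact X" by (rule compact_imp_seq_compact)
  moreover have "\<forall>n. v n \<in> X" using assms by (auto simp: X_def)
  ultimately obtain l r where "strict_mono r" "(v \<circ> r) \<longlonglongrightarrow> l"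
    by (auto elim!: seq_compactE)
  moreover have "(\<lambda>n. v (r n) i) \<longlonglongrightarrow> l i" for i
  proof -
    have "continuous_on UNIV (\<lambda>f::'i \<Rightarrow> real. f i)"
      by (rule continuous_on_product_coordinates)
    from continuous_on_tendsto_compose[OF this \<open>(v \<circ> r) \<longlonglongrightarrow> l\<close>] show ?thesis by (simp add: o_def)
  qed
  ultimately show ?thesis using that by blast
qed

text \<open>Additivity is Kolmogorov's consistency condition: the mass of a pattern on
  \<open>F\<close> is shared among its extensions to \<open>H\<close>.\<close>

lemma projective_digits:
  fixes L :: "'i set \<Rightarrow> 'i set \<Rightarrow> real"
  assumes nonneg: "\<And>F S. 0 \<le> L F S"
    and total: "L {} {} = 1"
    and additive: "\<And>F H S. finite H \<Longrightarrow> F \<subseteq> H \<Longrightarrow> S \<subseteq> F \<Longrightarrow>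
      L F S = (\<Sum>S'\<in>{S'\<in>Pow H. S' \<inter> F = S}. L H S')"
  obtains \<sigma> :: "('i \<Rightarrow> bool) measure"
    where "prob_space \<sigma>" "sets \<sigma> = sets (PiM UNIV (\<lambda>_. count_space UNIV))"
      "\<And>F S. finite F \<Longrightarrow> S \<subseteq> F \<Longrightarrow> measure \<sigma> (digit_cylinder \<sigma> (\<lambda>d a. a d) F S) = L F S"
proof -
  define Q where "Q F = point_measure (Pow F) (\<lambda>S. ennreal (L F S))" for F :: "'i set"
  \<comment> \<open>Kolmogorov's theorem is applied with real coordinates, so a pattern is recorded
    by the numbers 0 and 1.\<close>
  define b where "b F S = (\<lambda>d\<in>F. of_bool (d \<in> S) :: real)" for F S :: "'i set"
  define P where "P F = distr (Q F) (PiM F (\<lambda>_. borel)) (b F)" for F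
  have b[measurable]: "b F \<in> measurable (Q G) (PiM F (\<lambda>_. borel))" for F G
    by (auto simp: Q_def b_def space_PiM)
  have Q: "distr (Q H) (count_space (Pow F)) (\<lambda>S. S \<inter> F) = Q F" if H: "finite H" "F \<subseteq> H" for F H
  proof (rule measure_eqI_finite[where A="Pow F"])
    have finF: "finite F" using H finite_subset by blast
    fix S assume S: "S \<in> Pow F"
    have "emeasure (distr (Q H) (count_space (Pow F)) (\<lambda>S. S \<inter> F)) {S} =
        emeasure (Q H) {S'\<in>Pow H. S' \<inter> F = S}"
      using S H by (subst emeasure_distr)
        (auto simp: Q_def space_point_measure intro!: arg_cong2[where f=emeasure])
    also have "\<dots> = (\<Sum>S'\<in>{S'\<in>Pow H. S' \<inter> F = S}. ennreal (L H S'))"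
      using H unfolding Q_def by (subst emeasure_point_measure_finite) auto
    also have "\<dots> = ennreal (L F S)"
      using S H nonneg by (subst sum_ennreal) (auto simp: additive[of H F S])
    also have "\<dots> = emeasure (Q F) {S}"
      using finF S unfolding Q_def by (subst emeasure_point_measure_finite) auto
    finally show "emeasure (distr (Q H) (count_space (Pow F)) (\<lambda>S. S \<inter> F)) {S} = emeasure (Q F) {S}" .
  next
    show "finite (Pow F)" using H finite_subset by blast
  qed (auto simp: Q_def sets_point_measure)
  interpret polish_projective UNIV P
  proof (unfold polish_projective_def, rule projective_family.intro)
    fix F H :: "'i set" assume FH: "F \<subseteq> H" "finite H"
    have [measurable]: "(\<lambda>f. restrict f F) \<in> measurable (PiM H (\<lambda>_. borel)) (PiM F (\<lambda>_. borel :: real measure))"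
      using FH by (intro measurable_restrict_subset) auto
    have [measurable]: "(\<lambda>S. S \<inter> F) \<in> measurable (Q H) (count_space (Pow F))"
      by (auto simp: Q_def)
    have [measurable]: "b F \<in> measurable (count_space (Pow F)) (PiM F (\<lambda>_. borel))"
      by (auto simp: b_def space_PiM)
    have "distr (P H) (PiM F (\<lambda>_. borel)) (\<lambda>f. restrict f F) = 
        distr (Q H) (PiM F (\<lambda>_. borel)) ((\<lambda>f. restrict f F) \<circ> b H)"
      unfolding P_def by (subst distr_distr) auto
    also have "(\<lambda>f. restrict f F) \<circ> b H = b F \<circ> (\<lambda>S. S \<inter> F)"
      using FH by (auto simp: b_def fun_eq_iff restrict_def)
    also have "distr (Q H) (PiM F (\<lambda>_. borel)) (b F \<circ> (\<lambda>S. S \<inter> F)) =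
        distr (distr (Q H) (count_space (Pow F)) (\<lambda>S. S \<inter> F)) (PiM F (\<lambda>_. borel)) (b F)"
      by (subst distr_distr) (simp_all add: b_def space_PiM)
    also have "\<dots> = P F" using FH by (simp add: Q P_def)
    finally show "P F = distr (P H) (PiM F (\<lambda>_. borel)) (\<lambda>f. restrict f F)" ..
  next
    fix F :: "'i set" assume F: "finite F"
    \<comment> \<open>Every pattern on \<open>F\<close> extends the empty one, so additivity gives
      each \<open>Q F\<close> the total mass \<open>L {} {}\<close>.\<close>
    have "emeasure (Q F) (space (Q F)) = (\<Sum>S\<in>Pow F. ennreal (L F S))"
      using F unfolding Q_def by (subst emeasure_point_measure_finite) (auto simp: space_point_measure)
    also have "\<dots> = ennreal (L {} {})"
      using F nonneg by (subst sum_ennreal) (auto simp: additive[of F "{}" "{}"] intro!: arg_cong[where f=ennreal] sum.cong)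
    finally have "prob_space (Q F)" by (intro prob_spaceI) (simp add: total)
    then show "prob_space (P F)"
      unfolding P_def by (rule prob_space.prob_space_distr) measurable
  qed
  \<comment> \<open>Points of \<open>lim\<close> are arbitrary families of reals; testing for the
    value 1 turns each of them into a digit family.\<close>
  define \<sigma> where "\<sigma> = distr lim (PiM UNIV (\<lambda>_. count_space UNIV)) (\<lambda>a d. a d = 1)"
  have meas: "(\<lambda>a d. a d = (1::real)) \<in> measurable lim (PiM UNIV (\<lambda>_::'i. count_space UNIV))"
  proof (intro measurable_PiM_single')
    show "Measurable.pred lim (\<lambda>a. a d = (1::real))" for d
      unfolding measurable_cong_sets[OF sets_lim refl] by measurable
  qed (auto simp: space_PiM)
  have sets: "sets \<sigma> = sets (PiM UNIV (\<lambda>_. count_space UNIV))" by (simp add: \<sigma>_def)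
  have prob: "prob_space \<sigma>" unfolding \<sigma>_def by (rule P.prob_space_distr[OF meas])
  have D: "Measurable.pred \<sigma> (\<lambda>a. a d)" for d
    unfolding measurable_cong_sets[OF sets refl] by measurable
  have "measure \<sigma> (digit_cylinder \<sigma> (\<lambda>d a. a d) F S) = L F S" if F: "finite F" and S: "S \<subseteq> F" for F S
  proof -
    define X where "X = {x \<in> space (PiM F (\<lambda>_. borel)). \<forall>d\<in>F. (x d = (1::real)) = (d \<in> S)}"
    have X[measurable]: "X \<in> sets (PiM F (\<lambda>_. borel))"
      unfolding X_def using F by measurable
    have "digit_cylinder \<sigma> (\<lambda>d a. a d) F S \<in> sets (PiM UNIV (\<lambda>_. count_space UNIV))"
      unfolding sets[symmetric] by (rule sets_digit_cylinder[OF F D])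
    then have "measure \<sigma> (digit_cylinder \<sigma> (\<lambda>d a. a d) F S) =
        measure lim ((\<lambda>a d. a d = 1) -` digit_cylinder \<sigma> (\<lambda>d a. a d) F S \<inter> space lim)"
      unfolding \<sigma>_def by (rule measure_distr[OF meas])
    also have "(\<lambda>a d. a d = 1) -` digit_cylinder \<sigma> (\<lambda>d a. a d) F S \<inter> space lim = emb UNIV F X"
      by (auto simp: digit_cylinder_def X_def prod_emb_def space_PiM \<sigma>_def)
    also have "measure lim (emb UNIV F X) = measure (P F) X" using F X by (intro measure_lim_emb) auto
    also have "\<dots> = measure (Q F) (b F -` X \<inter> space (Q F))"
      unfolding P_def by (rule measure_distr) (use X in auto)
    also have "b F -` X \<inter> space (Q F) = {S}"
      using S by (auto simp: X_def b_def Q_def space_point_measure space_PiM)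
    also have "measure (Q F) {S} = L F S"
      unfolding Q_def Sigma_Algebra.measure_def using S F nonneg
      by (subst emeasure_point_measure_finite) auto
    finally show ?thesis .
  qed
  with prob sets show ?thesis by (rule that)
qed

text \<open>No topology on the underlying space is involved: functions of finitely many digits take
  the place of continuous test functions. Their finiteness matters, since an infinite coefficient
  times probabilities tending to 0 need not converge to 0.\<close>

lemma prob_digits_limit:
  fixes D :: "'i::countable \<Rightarrow> 'w \<Rightarrow> bool" and \<gamma> :: "nat \<Rightarrow> 'w measure"
  assumes prob: "\<And>n. prob_space (\<gamma> n)" and D: "\<And>n d. Measurable.pred (\<gamma> n) (D d)"
  obtains r and \<sigma> :: "('i \<Rightarrow> bool) measure"
  where "strict_mono r" "prob_space \<sigma>" "sets \<sigma> = sets (PiM UNIV (\<lambda>_. count_space UNIV))"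
    "\<And>F h. finite F \<Longrightarrow> (\<And>a b. (\<And>d. d \<in> F \<Longrightarrow> a d = b d) \<Longrightarrow> h a = h b) \<Longrightarrow>
      (\<And>a. h a < \<top>) \<Longrightarrow>
      (\<lambda>n. \<integral>\<^sup>+w. h (\<lambda>d. D d w) \<partial>\<gamma> (r n)) \<longlonglongrightarrow> (\<integral>\<^sup>+a. h a \<partial>\<sigma>)"
proof -
  \<comment> \<open>Pairs of lists stand for pairs of finite sets, because the choice of the
    subsequence asks for a countable index type.\<close>
  define v where "v n = (\<lambda>(xs, ys). measure (\<gamma> n) (digit_cylinder (\<gamma> n) D (set xs) (set ys)))" for n
  have "v n i \<in> {0..1}" for n i
    using prob_space.prob_le_1[OF prob] by (auto simp: v_def split: prod.splits)
  then obtain r l where r: "strict_mono r" and l: "\<And>i. (\<lambda>n. v (r n) i) \<longlonglongrightarrow> l i"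
    using convergent_subsequence_unit_interval[of v] by metis
  define m where "m n F S = measure (\<gamma> (r n)) (digit_cylinder (\<gamma> (r n)) D F S)" for n F S
  \<comment> \<open>Cutting \<open>S\<close> down to \<open>F\<close> makes the limit exist for
    every \<open>S\<close> once \<open>F\<close> is finite, so nonnegativity holds without the
    proviso \<open>S \<subseteq> F\<close>.\<close>
  define L where "L F S = Topological_Spaces.lim (\<lambda>n. m n F (S \<inter> F))" for F S
  have lim: "(\<lambda>n. m n F S) \<longlonglongrightarrow> L F S" if "finite F" "S \<subseteq> F" for F S
  proof -
    have "finite S" using that finite_subset by blast
    from finite_list[OF that(1)] finite_list[OF this]
    obtain xs ys where "set xs = F" "set ys = S" by auto
    then have "(\<lambda>n. m n F S) \<longlonglongrightarrow> l (xs, ys)" using l[of "(xs, ys)"] by (simp add: v_def m_def)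
    moreover from limI[OF this] have "L F S = l (xs, ys)" using that by (simp add: L_def Int_absorb2)
    ultimately show ?thesis by simp
  qed
  \<comment> \<open>For infinite \<open>F\<close> the limit may fail to exist, while
    \<open>projective_digits\<close> asks for nonnegativity at all \<open>F\<close>; hence the value
    0.\<close>
  define L' where "L' F S = (if finite F then L F S else 0)" for F S
  have L'_lim: "(\<lambda>n. m n F S) \<longlonglongrightarrow> L' F S" if "finite F" "S \<subseteq> F" for F S
    using lim[OF that] that by (simp add: L'_def)
  have nonneg: "0 \<le> L' F S" for F S
  proof -
    have "0 \<le> L F S" if "finite F"
    proof -
      have "L F S = L F (S \<inter> F)" by (simp add: L_def)
      moreover have "0 \<le> L F (S \<inter> F)"
        using lim[OF that, of "S \<inter> F"] by (intro LIMSEQ_le_const) (auto simp: m_def)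
      ultimately show ?thesis by simp
    qed
    then show ?thesis by (simp add: L'_def)
  qed
  have total: "L' {} {} = 1"
  proof -
    have "m n {} {} = 1" for n
      using prob_space.prob_space[OF prob] by (simp add: m_def digit_cylinder_def)
    then show ?thesis using L'_lim[of "{}" "{}"] by (auto dest: LIMSEQ_unique[OF tendsto_const])
  qed
  have additive: "L' F S = (\<Sum>S'\<in>{S'\<in>Pow H. S' \<inter> F = S}. L' H S')"
    if H: "finite H" "F \<subseteq> H" "S \<subseteq> F" for F H S
  proof -
    have fF: "finite F" using H finite_subset by blast
    have "m n F S = (\<Sum>S'\<in>{S'\<in>Pow H. S' \<inter> F = S}. m n H S')" for n
    proof -
      interpret prob_space "\<gamma> (r n)" by (rule prob)
      have "digit_cylinder (\<gamma> (r n)) D F S = 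
          (\<Union>S'\<in>{S'\<in>Pow H. S' \<inter> F = S}. digit_cylinder (\<gamma> (r n)) D H S')" (is "?l = ?u")
      proof
        show "?l \<subseteq> ?u"
        proof
          fix w assume "w \<in> ?l"
          then show "w \<in> ?u"
            using H by (auto simp: digit_cylinder_def intro!: exI[of _ "{d\<in>H. D d w}"])
        qed
        show "?u \<subseteq> ?l" using H by (auto simp: digit_cylinder_def)
      qed
      moreover have "disjoint_family_on (\<lambda>S'. digit_cylinder (\<gamma> (r n)) D H S') {S'\<in>Pow H. S' \<inter> F = S}"
        by (auto simp: disjoint_family_on_def digit_cylinder_def)
      ultimately show ?thesis
        unfolding m_def using H sets_digit_cylinder[OF H(1) D]
        by (subst finite_measure_finite_Union[symmetric]) auto
    qed
    moreover have "(\<lambda>n. \<Sum>S'\<in>{S'\<in>Pow H. S' \<inter> F = S}. m n H S') \<longlonglongrightarrow> (\<Sum>S'\<in>{S'\<in>Pow H. S' \<inter> F = S}. L' H S')"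
      using H by (intro tendsto_sum L'_lim) auto
    ultimately show ?thesis using L'_lim[OF fF H(3)] by (auto intro: LIMSEQ_unique)
  qed
  obtain \<sigma> :: "('i \<Rightarrow> bool) measure"
    where \<sigma>: "prob_space \<sigma>" "sets \<sigma> = sets (PiM UNIV (\<lambda>_. count_space UNIV))"
      "\<And>F S. finite F \<Longrightarrow> S \<subseteq> F \<Longrightarrow> measure \<sigma> (digit_cylinder \<sigma> (\<lambda>d a. a d) F S) = L' F S"
    by (rule projective_digits[of L']) (use nonneg total additive in auto)
  interpret \<sigma>: prob_space \<sigma> by fact
  have D\<sigma>: "Measurable.pred \<sigma> (\<lambda>a. a d)" for d
    unfolding measurable_cong_sets[OF \<sigma>(2) refl] by measurable
  show ?thesis
  proof (rule that[OF r \<sigma>(1,2)])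
    fix F :: "'i set" and h :: "('i \<Rightarrow> bool) \<Rightarrow> ennreal"
    assume F: "finite F" and h: "\<And>a b. (\<And>d. d \<in> F \<Longrightarrow> a d = b d) \<Longrightarrow> h a = h b"
      and fin: "\<And>a. h a < \<top>"
    have "(\<integral>\<^sup>+w. h (\<lambda>d. D d w) \<partial>\<gamma> (r n)) = (\<Sum>S\<in>Pow F. h (\<lambda>d. d \<in> S) * ennreal (m n F S))" for n
    proof -
      interpret prob_space "\<gamma> (r n)" by (rule prob)
      show ?thesis
        by (subst nn_integral_finite_digits[OF F D h])
          (simp_all add: m_def emeasure_eq_measure)
    qed
    moreover have "(\<integral>\<^sup>+a. h a \<partial>\<sigma>) = (\<Sum>S\<in>Pow F. h (\<lambda>d. d \<in> S) * ennreal (L' F S))"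
      using nn_integral_finite_digits[where D="\<lambda>d a. a d", OF F D\<sigma> h]
      using F by (auto simp: \<sigma>.emeasure_eq_measure \<sigma>(3) intro!: sum.cong)
    moreover have "(\<lambda>n. \<Sum>S\<in>Pow F. h (\<lambda>d. d \<in> S) * ennreal (m n F S))
        \<longlonglongrightarrow> (\<Sum>S\<in>Pow F. h (\<lambda>d. d \<in> S) * ennreal (L' F S))"
      using F L'_lim fin by (intro tendsto_sum ennreal_tendsto_cmult tendsto_ennrealI) auto
    ultimately show "(\<lambda>n. \<integral>\<^sup>+w. h (\<lambda>d. D d w) \<partial>\<gamma> (r n)) \<longlonglongrightarrow> (\<integral>\<^sup>+a. h a \<partial>\<sigma>)"
      by simp
  qed
qed

section \<open>Compactness of couplings\<close>

lemma dense_sequence: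
  obtains q :: "nat \<Rightarrow> 'a::{metric_space, second_countable_topology}"
  where "\<And>x e. 0 < e \<Longrightarrow> \<exists>k. dist x (q k) < e"
proof -
  obtain Q :: "'a set" where Q: "countable Q" "\<And>X. open X \<Longrightarrow> X \<noteq> {} \<Longrightarrow> \<exists>d\<in>Q. d \<in> X"
    using countable_dense_setE by blast
  have ne: "Q \<noteq> {}" using Q(2)[of UNIV] by auto
  have "\<exists>k. dist x (from_nat_into Q k) < e" if "0 < e" for x e
  proof -
    obtain d where "d \<in> Q" "d \<in> ball x e" using Q(2)[of "ball x e"] \<open>0 < e\<close> by auto
    then show ?thesis
      using from_nat_into_surj[OF Q(1)] by fastforce
  qed
  then show ?thesis by (rule that)
qed

text \<open>At level \<open>n\<close> the least marked \<open>k\<close> gives an approximant, which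
  on the code of \<open>x\<close> lies within 1/(n+1) of \<open>x\<close>. The decoder has to be
  defined and measurable on all digit sequences, since a limit measure is not known beforehand to be
  carried by codes.\<close>

lemma decode_digits:
  fixes q :: "nat \<Rightarrow> 'a::polish_space"
  assumes q: "\<And>x e. 0 < e \<Longrightarrow> \<exists>k. dist x (q k) < e"
  obtains g where "g \<in> measurable (PiM UNIV (\<lambda>_. count_space UNIV)) borel"
    "\<And>x. g (\<lambda>(n, k). dist x (q k) < 1 / Suc n) = x"
proof -
  let ?N = "PiM UNIV (\<lambda>_. count_space UNIV) :: (nat \<times> nat \<Rightarrow> bool) measure"
  define s where "s a n = q (LEAST k. a (n, k))" for a :: "nat \<times> nat \<Rightarrow> bool" and n
  have [measurable]: "Measurable.pred ?N (\<lambda>a. a d)" for d by measurable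
  have [measurable]: "(\<lambda>a. s a n) \<in> borel_measurable ?N" for n
  proof -
    have [measurable]: "(\<lambda>a. LEAST k. a (n, k)) \<in> measurable ?N (count_space UNIV)" by measurable
    have "q \<in> measurable (count_space UNIV) borel" by simp
    then show ?thesis unfolding s_def by measurable
  qed
  \<comment> \<open>On sequences that are not codes the approximants need not converge; freezing them keeps the decoder measurable.\<close>
  define s' where "s' a n = (if Cauchy (s a) then s a n else q 0)" for a n
  have [measurable]: "Measurable.pred ?N (\<lambda>a. Cauchy (s a))" 
    using sets_Collect_Cauchy[of "\<lambda>n a. s a n" ?N] by (simp add: pred_def)
  have s'_meas: "(\<lambda>a. s' a n) \<in> borel_measurable ?N" for n
    unfolding s'_def by measurable
  define g where "g a = Topological_Spaces.lim (s' a)" for a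
  have "convergent (s' a)" for a
    unfolding s'_def using Cauchy_convergent[of "s a"] by (cases "Cauchy (s a)") (auto simp: convergent_const)
  then have lim: "s' a \<longlonglongrightarrow> g a" for a
    unfolding g_def by (simp add: convergent_LIMSEQ_iff)
  have "g \<in> borel_measurable ?N"
    using lim by (intro borel_measurable_LIMSEQ_metric[where f="\<lambda>n a. s' a n", OF s'_meas]) auto
  moreover have "g (\<lambda>(n, k). dist x (q k) < 1 / Suc n) = x" for x
  proof -
    let ?a = "\<lambda>(n, k). dist x (q k) < 1 / Suc n"
    have d: "dist (s ?a n) x < 1 / Suc n" for n
      unfolding s_def prod.case using LeastI_ex[OF q[of "1 / Suc n" x]] by (simp add: dist_commute)
    have "s ?a \<longlonglongrightarrow> x"
    proof (rule metric_LIMSEQ_I)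
      fix r :: real assume "0 < r"
      then obtain n0 where n0: "1 / Suc n0 < r" using nat_approx_posE by blast
      have "dist (s ?a n) x < r" if "n \<ge> n0" for n
      proof -
        have "1 / Suc n \<le> 1 / Suc n0" using that by (simp add: frac_le)
        then show ?thesis using d[of n] n0 by simp
      qed
      then show "\<exists>no. \<forall>n\<ge>no. dist (s ?a n) x < r" by blast
    qed
    moreover from this have "s' ?a = s ?a"
      unfolding s'_def by (simp only: LIMSEQ_imp_Cauchy if_True)
    ultimately show ?thesis using LIMSEQ_unique[OF lim[of ?a], of x] by simp
  qed
  ultimately show ?thesis by (rule that)
qed

text \<open>This is lower semicontinuity on E^K for the maximum of the coordinate distances.
  Restricting to \<open>space (EJ K)\<close> selects the extensional functions that represent the
  points of E^K.\<close>

definition lsc_on_product :: "nat \<Rightarrow> ((nat \<Rightarrow> 'a::metric_space) \<Rightarrow> real) \<Rightarrow> bool" where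
  "lsc_on_product K c \<longleftrightarrow> (\<forall>x\<in>space (EJ K). \<forall>t<c x. \<exists>e>0.
     \<forall>y\<in>space (EJ K). (\<forall>i<K. dist (x i) (y i) < e) \<longrightarrow> t < c y)"

text \<open>Each rectangle of balls around dense points receives the infimum of \<open>c\<close>
  over it; by lower semicontinuity, small rectangles containing \<open>x\<close> have infima
  arbitrarily close to \<open>c x\<close> or above any number below it. All balls of one rectangle
  have the same radius, so that membership is a conjunction of digits of a single level.\<close>

lemma lsc_eq_SUP_rectangles:
  fixes q :: "nat \<Rightarrow> 'a::metric_space"
  assumes q: "\<And>x e. 0 < e \<Longrightarrow> \<exists>k. dist x (q k) < e"
    and lsc: "lsc_on_product K c" and nonneg: "\<And>x. x \<in> space (EJ K) \<Longrightarrow> 0 \<le> c x"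
  obtains v :: "nat \<Rightarrow> real" and n :: "nat \<Rightarrow> nat" and ks :: "nat \<Rightarrow> nat list"
  where "\<And>j. 0 \<le> v j"
    "\<And>x. x \<in> space (EJ K) \<Longrightarrow>
      ennreal (c x) = (SUP j. ennreal (v j * of_bool (\<forall>i<K. dist (x i) (q (ks j ! i)) < 1 / Suc (n j))))"
proof -
  define R where "R = (\<lambda>(n, ks). {y \<in> space (EJ K). \<forall>i<K. dist (y i) (q (ks ! i)) < 1 / Suc n})"
  \<comment> \<open>An infimum over the empty set would carry no information; the value 0 keeps
    \<open>v\<close> nonnegative, and the indicator of an empty rectangle vanishes anyway.\<close>
  define v where "v p = (if R p = {} then 0 else Inf (c ` R p))" for p :: "nat \<times> nat list"
  have v_le: "v p \<le> c x" if "x \<in> R p" for x p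
  proof -
    have "bdd_below (c ` R p)"
      using nonneg by (intro bdd_belowI[of _ 0]) (auto simp: R_def split: prod.splits)
    then show ?thesis using that by (auto simp: v_def intro: cInf_lower)
  qed
  have v_nonneg: "0 \<le> v p" for p
    using nonneg by (auto simp: v_def R_def split: prod.splits intro!: cInf_greatest)
  have eq: "ennreal (c x) = (SUP p. ennreal (v p * of_bool (x \<in> R p)))" if x: "x \<in> space (EJ K)" for x
  proof (rule antisym)
    show "ennreal (c x) \<le> (SUP p. ennreal (v p * of_bool (x \<in> R p)))"
    proof (rule dense_le)
      fix y assume y: "y < ennreal (c x)"
      then obtain t where t: "y = ennreal t" "0 \<le> t" "t < c x"
        by (cases y) (auto simp: ennreal_less_iff)
      then obtain e where e: "0 < e"
        "\<And>y. y \<in> space (EJ K) \<Longrightarrow> (\<And>i. i < K \<Longrightarrow> dist (x i) (y i) < e) \<Longrightarrow> t < c y"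
        using lsc x unfolding lsc_on_product_def by meson
      \<comment> \<open>Two points in one ball of radius 1/(n+1) are then less than \<open>e\<close>
        apart.\<close>
      obtain n where n: "1 / Suc n < e / 2" using nat_approx_posE[of "e / 2"] e by auto
      define ks where "ks = map (\<lambda>i. SOME k. dist (x i) (q k) < 1 / Suc n) [0..<K]"
      have ks: "dist (x i) (q (ks ! i)) < 1 / Suc n" if "i < K" for i
        using that someI_ex[OF q[of "1 / Suc n" "x i"]] by (simp add: ks_def)
      have xR: "x \<in> R (n, ks)" using x ks by (simp add: R_def)
      have "t \<le> c y" if "y \<in> R (n, ks)" for y
      proof -
        have "dist (x i) (y i) < e" if "i < K" for i
          using ks[OF that] \<open>y \<in> R (n, ks)\<close> that n dist_triangle2[of "x i" "y i" "q (ks ! i)"]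
          by (force simp: R_def)
        then show ?thesis using e(2)[of y] that by (simp add: R_def)
      qed
      then have "t \<le> v (n, ks)" using xR by (auto simp: v_def intro!: cInf_greatest)
      then have "y \<le> ennreal (v (n, ks) * of_bool (x \<in> R (n, ks)))" using xR t by (simp add: ennreal_leI)
      then show "y \<le> (SUP p. ennreal (v p * of_bool (x \<in> R p)))" by (rule SUP_upper2[OF UNIV_I])
    qed
    show "(SUP p. ennreal (v p * of_bool (x \<in> R p))) \<le> ennreal (c x)"
      using v_le nonneg[OF x] by (intro SUP_least ennreal_leI) auto
  qed
  define f :: "nat \<Rightarrow> nat \<times> nat list" where "f = from_nat"
  have range: "range f = UNIV" unfolding f_def by (rule surj_from_nat)
  show ?thesis
  proof (rule that[of "\<lambda>j. v (f j)" "\<lambda>j. snd (f j)" "\<lambda>j. fst (f j)"])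
    fix x :: "nat \<Rightarrow> 'a" assume x: "x \<in> space (EJ K)"
    have "ennreal (c x) = (SUP p\<in>range f. ennreal (v p * of_bool (x \<in> R p)))"
      unfolding eq[OF x] range ..
    also have "\<dots> = (SUP j. ennreal (v (f j) * of_bool (x \<in> R (f j))))"
      by (simp only: image_image)
    finally show "ennreal (c x) = (SUP j. ennreal (v (f j) * of_bool
        (\<forall>i<K. dist (x i) (q (snd (f j) ! i)) < 1 / Suc (fst (f j)))))"
      using x by (simp add: R_def split_beta)
  qed (rule v_nonneg)
qed

text \<open>Rectangles of balls belong to the product sigma-algebra, and countably many of them
  suffice to describe \<open>c\<close>.\<close>

lemma lsc_on_product_measurable:
  fixes c :: "(nat \<Rightarrow> 'a::polish_space) \<Rightarrow> real"
  assumes "lsc_on_product K c" "\<And>x. x \<in> space (EJ K) \<Longrightarrow> 0 \<le> c x"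
  shows "(\<lambda>x. ennreal (c x)) \<in> borel_measurable (EJ K)"
proof -
  obtain q :: "nat \<Rightarrow> 'a" where q: "\<And>x e. 0 < e \<Longrightarrow> \<exists>k. dist x (q k) < e"
    using dense_sequence by blast
  obtain v :: "nat \<Rightarrow> real" and n :: "nat \<Rightarrow> nat" and ks :: "nat \<Rightarrow> nat list" where *: "\<And>x. x \<in> space (EJ K) \<Longrightarrow>
      ennreal (c x) = (SUP j. ennreal (v j * of_bool (\<forall>i<K. dist (x i) (q (ks j ! i)) < 1 / Suc (n j))))"
    by (rule lsc_eq_SUP_rectangles[OF q assms]) blast+
  have "(\<lambda>x. SUP j. ennreal (v j * of_bool (\<forall>i<K. dist (x i) (q (ks j ! i)) < 1 / Suc (n j))))
      \<in> borel_measurable (EJ K)"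
  proof (rule borel_measurable_SUP)
    fix j
    have [measurable]: "(\<lambda>x. x i) \<in> measurable (EJ K) (borel :: 'a measure)" if "i \<in> {..<K}" for i
      using that by measurable
    have "Measurable.pred (EJ K) (\<lambda>x. \<forall>i\<in>{..<K}. dist (x i) (q (ks j ! i)) < 1 / Suc (n j))"
      by measurable
    then have [measurable]: "Measurable.pred (EJ K) (\<lambda>x. \<forall>i<K. dist (x i) (q (ks j ! i)) < 1 / Suc (n j))"
      by (simp add: Ball_def)
    show "(\<lambda>x. ennreal (v j * of_bool (\<forall>i<K. dist (x i) (q (ks j ! i)) < 1 / Suc (n j))))
        \<in> borel_measurable (EJ K)"
      unfolding of_bool_def by measurable
  qed simp
  then show ?thesis
    using * by (subst measurable_cong) auto
qed

text \<open>The decoded limit has the limiting digit probabilities exactly. Hence every finite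
  partial supremum of rectangle functions below \<open>c\<close> has converging integrals, and
  monotone convergence turns this into the bound by the limit inferior.\<close>

lemma couplings_limit:
  fixes \<gamma> :: "nat \<Rightarrow> (nat \<Rightarrow> 'a::polish_space) measure"
  assumes \<gamma>: "\<And>n. \<gamma> n \<in> couplings K \<mu>"
  obtains r \<gamma>' where "strict_mono r" "\<gamma>' \<in> couplings K \<mu>"
    "\<And>c. lsc_on_product K c \<Longrightarrow> (\<And>x. x \<in> space (EJ K) \<Longrightarrow> 0 \<le> c x) \<Longrightarrow>
      (\<integral>\<^sup>+x. ennreal (c x) \<partial>\<gamma>') \<le> liminf (\<lambda>n. \<integral>\<^sup>+x. ennreal (c x) \<partial>\<gamma> (r n))"
proof -
  have sets_\<gamma>: "sets (\<gamma> n) = sets (EJ K)" and prob_\<gamma>: "prob_space (\<gamma> n)"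
    and marg: "\<And>i. i < K \<Longrightarrow> distr (\<gamma> n) borel (\<lambda>x. x i) = \<mu> i" for n
    using \<gamma>[of n] by (auto simp: couplings_def)
  have space_\<gamma>: "space (\<gamma> n) = space (EJ K)" for n
    by (rule sets_eq_imp_space_eq[OF sets_\<gamma>])
  have sets_\<mu>: "sets (\<mu> i) = sets borel" if "i < K" for i
    using marg[OF that, of 0] by (metis sets_distr)
  obtain q :: "nat \<Rightarrow> 'a" where q: "\<And>x e. 0 < e \<Longrightarrow> \<exists>k. dist x (q k) < e"
    using dense_sequence by blast
  define near where "near d x \<longleftrightarrow> dist x (q (snd d)) < 1 / Suc (fst d)" for d :: "nat \<times> nat" and x
  \<comment> \<open>The guard switches off digits of coordinates outside \<open>{..<K}\<close>, so
    that every \<open>D d\<close> is measurable on \<open>EJ K\<close> and all triples can serve as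
    indices.\<close>
  define D where "D d x \<longleftrightarrow> fst d < K \<and> near (snd d) (x (fst d))" for d and x :: "nat \<Rightarrow> 'a"
  let ?N = "PiM UNIV (\<lambda>_. count_space UNIV) :: (nat \<times> nat \<Rightarrow> bool) measure"
  define \<phi> where "\<phi> x = (\<lambda>d. near d x)" for x
  obtain g where g: "g \<in> measurable ?N borel" and g\<phi>: "\<And>x. g (\<phi> x) = x"
    using decode_digits[OF q] unfolding \<phi>_def near_def case_prod_beta by blast
  have near[measurable]: "Measurable.pred borel (near d)" for d
    unfolding near_def by measurable
  have \<phi>: "\<phi> \<in> measurable borel ?N"
    unfolding \<phi>_def by (rule measurable_PiM_single') (auto simp: space_PiM)
  have D: "Measurable.pred (EJ K) (D d)" for d
  proof (cases "fst d < K")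
    case True
    then have [measurable]: "(\<lambda>x. x (fst d)) \<in> measurable (EJ K) (borel :: 'a measure)"
      by (intro measurable_component_singleton) simp
    show ?thesis unfolding D_def using True by measurable
  next
    case False
    then show ?thesis unfolding D_def by simp
  qed
  have D\<gamma>: "Measurable.pred (\<gamma> n) (D d)" for n d
    using D by (simp add: measurable_cong_sets[OF sets_\<gamma> refl])
  obtain r and \<sigma> :: "(nat \<times> nat \<times> nat \<Rightarrow> bool) measure"
  where r: "strict_mono r" and prob_\<sigma>: "prob_space \<sigma>"
    and sets_\<sigma>: "sets \<sigma> = sets (PiM UNIV (\<lambda>_. count_space UNIV))"
    and lim: "\<And>F h. finite F \<Longrightarrow> (\<And>a b. (\<And>d. d \<in> F \<Longrightarrow> a d = b d) \<Longrightarrow> h a = h b) \<Longrightarrow>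
      (\<And>a. h a < \<top>) \<Longrightarrow>
      (\<lambda>n. \<integral>\<^sup>+w. h (\<lambda>d. D d w) \<partial>\<gamma> (r n)) \<longlonglongrightarrow> (\<integral>\<^sup>+a. h a \<partial>\<sigma>)"
    by (rule prob_digits_limit[of \<gamma> D, OF prob_\<gamma> D\<gamma>]) blast+
  define proj where "proj i a = (\<lambda>d. a (i, d))" for i :: nat and a :: "nat \<times> nat \<times> nat \<Rightarrow> bool"
  have proj: "proj i \<in> measurable \<sigma> ?N" for i
    unfolding proj_def measurable_cong_sets[OF sets_\<sigma> refl]
    by (rule measurable_PiM_single') (auto simp: space_PiM)
  define G where "G a = (\<lambda>i\<in>{..<K}. g (proj i a))" for a
  have g_proj: "(\<lambda>a. g (proj i a)) \<in> measurable \<sigma> borel" for i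
    using measurable_comp[OF proj g] by (simp add: comp_def)
  have G: "G \<in> measurable \<sigma> (EJ K)"
    unfolding G_def using g_proj by (intro measurable_restrict)
  \<comment> \<open>On a finite cylinder the probability under \<open>\<gamma> (r n)\<close> is the
    same for all \<open>n\<close>, being determined by the marginal \<open>\<mu> i\<close>; the
    limit is this constant.\<close>
  have marg_\<sigma>: "distr \<sigma> ?N (proj i) = distr (\<mu> i) ?N \<phi>" if i: "i < K" for i
  proof (rule measure_eqI_PiM_infinite)
    fix A and S :: "(nat \<times> nat) set"
    assume S: "finite S" and A: "\<And>d. d \<in> S \<Longrightarrow> A d \<in> sets (count_space (UNIV :: bool set))"
    define Z where "Z = prod_emb UNIV (\<lambda>_. count_space UNIV :: bool measure) S (Pi\<^sub>E S A)"
    have Z: "Z \<in> sets ?N" unfolding Z_def using S A by (intro sets_PiM_I) auto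
    have Z_iff: "a \<in> Z \<longleftrightarrow> (\<forall>d\<in>S. a d \<in> A d)" for a
      by (auto simp: Z_def prod_emb_def)
    have "(\<lambda>n. \<integral>\<^sup>+w. indicator Z (proj i (\<lambda>d. D d w)) \<partial>\<gamma> (r n)) \<longlonglongrightarrow> (\<integral>\<^sup>+a. indicator Z (proj i a) \<partial>\<sigma>)"
    proof (rule lim[where F="Pair i ` S"])
      fix a b :: "nat \<times> nat \<times> nat \<Rightarrow> bool" assume "\<And>d. d \<in> Pair i ` S \<Longrightarrow> a d = b d"
      then have "proj i a \<in> Z \<longleftrightarrow> proj i b \<in> Z" by (auto simp: Z_iff proj_def)
      then show "indicator Z (proj i a) = (indicator Z (proj i b) :: ennreal)" by (simp add: indicator_def)
    qed (use S in \<open>auto simp: indicator_def\<close>)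
    moreover have "(\<integral>\<^sup>+w. indicator Z (proj i (\<lambda>d. D d w)) \<partial>\<gamma> n) = emeasure (distr (\<mu> i) ?N \<phi>) Z" for n
    proof -
      have xi: "(\<lambda>x. x i) \<in> measurable (\<gamma> n) borel"
        unfolding measurable_cong_sets[OF sets_\<gamma> refl] using i by (intro measurable_component_singleton) simp
      have "(\<integral>\<^sup>+w. indicator Z (proj i (\<lambda>d. D d w)) \<partial>\<gamma> n) = (\<integral>\<^sup>+w. indicator Z (\<phi> (w i)) \<partial>\<gamma> n)"
        using i by (simp add: proj_def D_def \<phi>_def)
      also have "\<dots> = (\<integral>\<^sup>+x. indicator Z (\<phi> x) \<partial>distr (\<gamma> n) borel (\<lambda>x. x i))"
        by (intro nn_integral_distr[symmetric] xi)
          (simp add: measurable_compose[OF \<phi> borel_measurable_indicator[OF Z]])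
      also have "\<dots> = (\<integral>\<^sup>+a. indicator Z a \<partial>distr (\<mu> i) ?N \<phi>)"
        unfolding marg[OF i]
        using Z \<phi> by (intro nn_integral_distr[symmetric]) (auto simp: measurable_cong_sets[OF sets_\<mu>[OF i] refl])
      finally show ?thesis using Z by simp
    qed
    moreover have "(\<integral>\<^sup>+a. indicator Z (proj i a) \<partial>\<sigma>) = emeasure (distr \<sigma> ?N (proj i)) Z"
      using Z nn_integral_distr[OF proj, of "indicator Z"] by simp
    ultimately have "(\<lambda>_::nat. emeasure (distr (\<mu> i) ?N \<phi>) Z) \<longlonglongrightarrow> emeasure (distr \<sigma> ?N (proj i)) Z"
      by simp
    then show "emeasure (distr \<sigma> ?N (proj i)) Z = emeasure (distr (\<mu> i) ?N \<phi>) Z"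
      by (rule LIMSEQ_unique[OF _ tendsto_const])
  next
    show "finite_measure (distr \<sigma> ?N (proj i))"
      using prob_space.prob_space_distr[OF prob_\<sigma> proj] by (rule prob_space.finite_measure)
  qed simp_all
  have \<phi>\<mu>: "\<phi> \<in> measurable (\<mu> i) ?N" if "i < K" for i
    using \<phi> by (simp add: measurable_cong_sets[OF sets_\<mu>[OF that] refl])
  have in_couplings: "distr \<sigma> (EJ K) G \<in> couplings K \<mu>"
    unfolding couplings_def
  proof (intro CollectI conjI allI impI)
    show "prob_space (distr \<sigma> (EJ K) G)" by (rule prob_space.prob_space_distr[OF prob_\<sigma> G])
    fix i assume i: "i < K"
    have xi: "(\<lambda>x. x i) \<in> measurable (EJ K) (borel :: 'a measure)"
      using i by (intro measurable_component_singleton) simp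
    have "distr (distr \<sigma> (EJ K) G) borel (\<lambda>x. x i) = distr \<sigma> borel (g \<circ> proj i)"
      using i by (subst distr_distr[OF xi G]) (simp add: comp_def G_def)
    also have "\<dots> = distr (distr \<sigma> ?N (proj i)) borel g"
      by (rule distr_distr[OF g proj, symmetric])
    also have "\<dots> = distr (\<mu> i) borel (g \<circ> \<phi>)"
      unfolding marg_\<sigma>[OF i] by (rule distr_distr[OF g \<phi>\<mu>[OF i]])
    also have "\<dots> = \<mu> i"
      using sets_\<mu>[OF i] by (simp add: comp_def g\<phi> distr_id2)
    finally show "distr (distr \<sigma> (EJ K) G) borel (\<lambda>x. x i) = \<mu> i" .
  qed simp
  \<comment> \<open>The marginals do not change along the sequence, so almost every limiting digit sequence is the
    code of a point of the product. This takes the place of tightness.\<close>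
  have AE: "AE a in \<sigma>. \<forall>i<K. \<phi> (g (proj i a)) = proj i a"
  proof -
    have "AE a in \<sigma>. \<phi> (g (proj i a)) = proj i a" if i: "i < K" for i
    proof -
      have [measurable]: "Measurable.pred ?N (\<lambda>b. near d (g b))" for d
        using measurable_compose[OF g near] by simp
      have [measurable]: "Measurable.pred ?N (\<lambda>b. b d)" for d by measurable
      have "Measurable.pred ?N (\<lambda>b. \<forall>d. near d (g b) = b d)" by measurable
      then have "{b \<in> space ?N. \<phi> (g b) = b} \<in> sets ?N"
        by (simp add: \<phi>_def fun_eq_iff pred_def)
      then have "AE b in distr (\<mu> i) ?N \<phi>. \<phi> (g b) = b"
        by (subst AE_distr_iff[OF \<phi>\<mu>[OF i]]) (auto simp: g\<phi>)
      then have "AE b in distr \<sigma> ?N (proj i). \<phi> (g b) = b"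
        unfolding marg_\<sigma>[OF i] .
      from AE_distrD[OF proj this] show ?thesis .
    qed
    then show ?thesis by (simp add: AE_all_countable)
  qed
  have D_G: "D (i, d) (G a) = a (i, d)" if "\<forall>i<K. \<phi> (g (proj i a)) = proj i a" "i < K" for i d a
  proof -
    have "\<phi> (g (proj i a)) d = proj i a d" using that by simp
    then show ?thesis using that(2) by (simp add: D_def G_def \<phi>_def proj_def)
  qed
  show ?thesis
  proof (rule that[OF r in_couplings])
    fix c :: "(nat \<Rightarrow> 'a) \<Rightarrow> real" assume lsc: "lsc_on_product K c" and nonneg: "\<And>x. x \<in> space (EJ K) \<Longrightarrow> 0 \<le> c x"
    obtain v :: "nat \<Rightarrow> real" and n :: "nat \<Rightarrow> nat" and ks :: "nat \<Rightarrow> nat list"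
    where v: "\<And>j. 0 \<le> v j" and c_eq: "\<And>x. x \<in> space (EJ K) \<Longrightarrow>
      ennreal (c x) = (SUP j. ennreal (v j * of_bool (\<forall>i<K. dist (x i) (q (ks j ! i)) < 1 / Suc (n j))))"
      by (rule lsc_eq_SUP_rectangles[OF q lsc nonneg]) blast+
    define R where "R j a \<longleftrightarrow> (\<forall>i\<in>{..<K}. a (i, n j, ks j ! i))" for j and a :: "nat \<times> nat \<times> nat \<Rightarrow> bool"
    \<comment> \<open>A partial supremum reads only the finitely many digits in \<open>F m\<close>,
      so its integrals converge along the subsequence.\<close>
    define h where "h m a = (SUP j\<in>{..m}. ennreal (v j * of_bool (R j a)))" for m a
    define F where "F m = (\<Union>j\<in>{..m}. (\<lambda>i. (i, n j, ks j ! i)) ` {..<K})" for m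
    have c_SUP: "ennreal (c x) = (SUP m. h m (\<lambda>d. D d x))" if "x \<in> space (EJ K)" for x
    proof -
      have "ennreal (c x) = (SUP j. ennreal (v j * of_bool (R j (\<lambda>d. D d x))))"
        unfolding c_eq[OF that] by (simp add: R_def D_def near_def Ball_def)
      also have "\<dots> = (SUP m. h m (\<lambda>d. D d x))"
        unfolding h_def
        by (intro antisym SUP_least, rule SUP_upper2[OF UNIV_I], rule SUP_upper, rule atMost_iff[THEN iffD2],
            rule order_refl, rule SUP_upper, rule UNIV_I)
      finally show ?thesis .
    qed
    have h_D: "(\<lambda>x. h m (\<lambda>d. D d x)) \<in> borel_measurable (EJ K)" for m
    proof -
      have [measurable]: "Measurable.pred (EJ K) (D d)" for d by (rule D)
      show ?thesis unfolding h_def R_def of_bool_def by measurable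
    qed
    have h_cong: "h m a = h m b" if "\<And>d. d \<in> F m \<Longrightarrow> a d = b d" for m a b
    proof -
      have "R j a = R j b" if j: "j \<le> m" for j
      proof -
        have "a (i, n j, ks j ! i) = b (i, n j, ks j ! i)" if "i \<in> {..<K}" for i
          using j that by (intro \<open>\<And>d. d \<in> F m \<Longrightarrow> a d = b d\<close>)
            (unfold F_def, intro UN_I[of j] image_eqI[of _ _ i], simp_all)
        then show ?thesis by (simp add: R_def)
      qed
      then show ?thesis unfolding h_def by (intro SUP_cong) auto
    qed
    have h_fin: "h m a < \<top>" for m a
    proof -
      have "h m a \<le> ennreal (\<Sum>j\<in>{..m}. v j)"
        unfolding h_def
      proof (rule SUP_least, rule ennreal_leI)
        fix j assume "j \<in> {..m}"
        then have "v j \<le> (\<Sum>j\<in>{..m}. v j)" using v by (intro member_le_sum) auto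
        then show "v j * of_bool (R j a) \<le> (\<Sum>j\<in>{..m}. v j)"
          using v by (auto simp: sum_nonneg)
      qed
      then show ?thesis by (rule le_less_trans) simp
    qed
    let ?\<gamma>' = "distr \<sigma> (EJ K) G"
    have "(\<integral>\<^sup>+x. ennreal (c x) \<partial>?\<gamma>') = (\<integral>\<^sup>+x. (SUP m. h m (\<lambda>d. D d x)) \<partial>?\<gamma>')"
      using c_SUP by (intro nn_integral_cong) auto
    also have "\<dots> = (SUP m. \<integral>\<^sup>+x. h m (\<lambda>d. D d x) \<partial>?\<gamma>')"
    proof (rule nn_integral_monotone_convergence_SUP)
      show "incseq (\<lambda>m x. h m (\<lambda>d. D d x))"
        unfolding h_def by (auto simp: incseq_def le_fun_def intro!: SUP_subset_mono)
      show "(\<lambda>x. h m (\<lambda>d. D d x)) \<in> borel_measurable ?\<gamma>'" for m using h_D by simp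
    qed
    also have "\<dots> \<le> liminf (\<lambda>n. \<integral>\<^sup>+x. ennreal (c x) \<partial>\<gamma> (r n))"
    proof (rule SUP_least)
      fix m
      have "(\<integral>\<^sup>+x. h m (\<lambda>d. D d x) \<partial>?\<gamma>') = (\<integral>\<^sup>+a. h m (\<lambda>d. D d (G a)) \<partial>\<sigma>)"
        by (rule nn_integral_distr[OF G]) (use h_D in simp)
      also have "\<dots> = (\<integral>\<^sup>+a. h m a \<partial>\<sigma>)"
        using AE by (intro nn_integral_cong_AE)
          (auto elim!: eventually_mono intro!: h_cong simp: F_def D_G)
      also have "\<dots> = liminf (\<lambda>n. \<integral>\<^sup>+x. h m (\<lambda>d. D d x) \<partial>\<gamma> (r n))"
        using lim[of "F m" "h m", OF _ h_cong h_fin]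
        by (intro lim_imp_Liminf[symmetric]) (auto simp: F_def)
      also have "\<dots> \<le> liminf (\<lambda>n. \<integral>\<^sup>+x. ennreal (c x) \<partial>\<gamma> (r n))"
        by (intro Liminf_mono always_eventually allI nn_integral_mono)
          (auto simp: space_\<gamma> c_SUP intro: SUP_upper)
      finally show "(\<integral>\<^sup>+x. h m (\<lambda>d. D d x) \<partial>?\<gamma>') \<le> liminf (\<lambda>n. \<integral>\<^sup>+x. ennreal (c x) \<partial>\<gamma> (r n))" .
    qed
    finally show "(\<integral>\<^sup>+x. ennreal (c x) \<partial>?\<gamma>') \<le> liminf (\<lambda>n. \<integral>\<^sup>+x. ennreal (c x) \<partial>\<gamma> (r n))" .
  qed
qed

section \<open>Existence of optimal couplings\<close>

lemma couplings_nonempty: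
  fixes \<mu> :: "nat \<Rightarrow> 'a::topological_space measure"
  assumes "\<And>i. i < K \<Longrightarrow> sets (\<mu> i) = sets borel" "\<And>i. i < K \<Longrightarrow> prob_space (\<mu> i)"
  shows "couplings K \<mu> \<noteq> {}"
proof -
  have "PiM {..<K} \<mu> \<in> couplings K \<mu>"
    unfolding couplings_def
  proof (intro CollectI conjI allI impI)
    show "sets (PiM {..<K} \<mu>) = sets (EJ K)" using assms by (intro sets_PiM_cong) auto
    show "prob_space (PiM {..<K} \<mu>)" using assms by (intro prob_space_PiM) auto
    fix i assume i: "i < K"
    have "distr (PiM {..<K} \<mu>) borel (\<lambda>x. x i) = distr (PiM {..<K} \<mu>) (\<mu> i) (\<lambda>x. x i)"
      using assms i by (intro distr_cong) auto
    also have "\<dots> = \<mu> i" using assms i by (intro distr_PiM_component) auto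
    finally show "distr (PiM {..<K} \<mu>) borel (\<lambda>x. x i) = \<mu> i" .
  qed
  then show ?thesis by blast
qed

text \<open>Stated for general \<open>K\<close> and \<open>c\<close> because two costs are
  minimized: the multi-marginal cost on E^J, and in \<open>optimal_gluing\<close> the cost relative
  to the last coordinate on E^(J+1).\<close>

lemma couplings_attain_minimum:
  fixes \<mu> :: "nat \<Rightarrow> 'a::polish_space measure"
  assumes ne: "couplings K \<mu> \<noteq> {}"
    and lsc: "lsc_on_product K c" and nonneg: "\<And>x. x \<in> space (EJ K) \<Longrightarrow> 0 \<le> c x"
  obtains \<gamma> where "\<gamma> \<in> couplings K \<mu>"
    "\<And>\<gamma>'. \<gamma>' \<in> couplings K \<mu> \<Longrightarrow> (\<integral>\<^sup>+x. ennreal (c x) \<partial>\<gamma>) \<le> (\<integral>\<^sup>+x. ennreal (c x) \<partial>\<gamma>')"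
proof -
  define I where "I \<gamma> = (\<integral>\<^sup>+x. ennreal (c x) \<partial>\<gamma>)" for \<gamma>
  have "I ` couplings K \<mu> \<noteq> {}" using ne by simp
  from ennreal_Inf_countable_INF[OF this] obtain f :: "nat \<Rightarrow> ennreal"
    where f: "decseq f" "range f \<subseteq> I ` couplings K \<mu>" "Inf (I ` couplings K \<mu>) = (INF i. f i)" by blast
  from f(2) have "\<forall>n. \<exists>\<gamma>. \<gamma> \<in> couplings K \<mu> \<and> f n = I \<gamma>" by auto
  then obtain \<gamma> where \<gamma>: "\<And>n. \<gamma> n \<in> couplings K \<mu>" "\<And>n. f n = I (\<gamma> n)" by metis
  from couplings_limit[of \<gamma>, OF \<gamma>(1)] obtain r \<gamma>' where r: "strict_mono r" "\<gamma>' \<in> couplings K \<mu>"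
    "\<And>c. lsc_on_product K c \<Longrightarrow> (\<And>x. x \<in> space (EJ K) \<Longrightarrow> 0 \<le> c x) \<Longrightarrow>
      (\<integral>\<^sup>+x. ennreal (c x) \<partial>\<gamma>') \<le> liminf (\<lambda>n. \<integral>\<^sup>+x. ennreal (c x) \<partial>\<gamma> (r n))" by metis
  have "(\<lambda>n. f (r n)) \<longlonglongrightarrow> (INF i. f i)"
    using LIMSEQ_subseq_LIMSEQ[OF LIMSEQ_INF[OF f(1)] r(1)] by (simp add: comp_def)
  then have "liminf (\<lambda>n. f (r n)) = (INF i. f i)" by (intro lim_imp_Liminf) auto
  moreover have "I \<gamma>' \<le> liminf (\<lambda>n. f (r n))"
    unfolding \<gamma>(2) unfolding I_def by (rule r(3)[OF lsc nonneg])
  ultimately have "I \<gamma>' \<le> Inf (I ` couplings K \<mu>)" using f(3) by simp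
  then have "I \<gamma>' \<le> I \<gamma>''" if "\<gamma>'' \<in> couplings K \<mu>" for \<gamma>''
    using that by (meson INF_lower order_trans)
  then show ?thesis using that[OF r(2)] unfolding I_def by blast
qed

section \<open>Approximate gluing\<close>

text \<open>For \<open>s\<close> near 0 the factor of \<open>a powr p\<close> is near 1, so a small
  error \<open>b\<close> in a distance is absorbed at little cost. The constants come from writing a
  + b as the convex combination (1 - s) * (a / (1 - s)) + s * (b / s).\<close>

lemma powr_add_le:
  fixes a b s p :: real
  assumes ab: "0 \<le> a" "0 \<le> b" and s: "0 < s" "s < 1" and p: "1 \<le> p"
  shows "(a + b) powr p \<le> (1 - s) powr (1 - p) * a powr p + s powr (1 - p) * b powr p"
proof -
  have ge1: "1 \<le> r powr (1 - p)" if "0 < r" "r < 1" for r :: real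
  proof -
    have "r powr 0 \<le> r powr (1 - p)" using that p by (intro powr_mono') auto
    then show ?thesis using that by simp
  qed
  have scale: "r * (c / r) powr p = r powr (1 - p) * c powr p" if "0 < r" "0 < c" for r c :: real
    using that by (simp add: powr_divide powr_diff)
  consider "a = 0" | "b = 0" | "0 < a" "0 < b" using ab by linarith
  then show ?thesis
  proof cases
    case 1
    have "1 * b powr p \<le> s powr (1 - p) * b powr p"
      using ge1[OF s] by (intro mult_right_mono) auto
    with 1 show ?thesis by simp
  next
    case 2
    have "1 * a powr p \<le> (1 - s) powr (1 - p) * a powr p"
      using ge1[of "1 - s"] s by (intro mult_right_mono) auto
    with 2 show ?thesis by simp
  next
    case 3
    \<comment> \<open>convexity of the power at the points \<open>a / (1 - s)\<close> and \<open>b / s\<close>\<close>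
    have "((1 - s) *\<^sub>R (a / (1 - s)) + s *\<^sub>R (b / s)) powr p
        \<le> (1 - s) * (a / (1 - s)) powr p + s * (b / s) powr p"
      using 3 s by (intro convex_onD[OF powr_convex[OF p]]) auto
    moreover have "(1 - s) *\<^sub>R (a / (1 - s)) + s *\<^sub>R (b / s) = a + b" using s by simp
    ultimately show ?thesis using 3 s by (simp add: scale)
  qed
qed

text \<open>The order of choice matters: \<open>s\<close> is taken small enough for the first term
  to stay below \<open>u\<close>, and only then \<open>e\<close>, since for p > 1 the factor
  \<open>s powr (1 - p)\<close> grows without bound as \<open>s\<close> tends to 0. A negative
  \<open>t\<close> is allowed because \<open>lsc_on_product\<close> quantifies over all real
  levels.\<close>

lemma powr_perturbation:
  fixes t u p :: real
  assumes "t < u" "1 \<le> p"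
  obtains s e where "0 < s" "s < 1" "0 < e" "(1 - s) powr (1 - p) * t + s powr (1 - p) * e powr p < u"
proof -
  have "((\<lambda>s. (1 - s) powr (1 - p) * t) \<longlongrightarrow> (1 - 0) powr (1 - p) * t) (at_right 0)"
    by (intro tendsto_intros) auto
  then have "\<forall>\<^sub>F s in at_right 0. (1 - s) powr (1 - p) * t < u"
    using \<open>t < u\<close> by (intro order_tendstoD(2)[where y="t"]) auto
  moreover have "\<forall>\<^sub>F s :: real in at_right 0. s \<in> {0<..<1}"
    by (rule eventually_at_right_real) simp
  ultimately have "\<forall>\<^sub>F s in at_right 0. (1 - s) powr (1 - p) * t < u \<and> 0 < s \<and> s < 1"
    by eventually_elim auto
  then obtain s where s: "(1 - s) powr (1 - p) * t < u" "0 < s" "s < 1"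
    using eventually_happens[of _ "at_right (0::real)"] by auto
  define d where "d = u - (1 - s) powr (1 - p) * t"
  \<comment> \<open>Solved from the requirement that the second term be half of the gap
    \<open>d\<close>.\<close>
  define e where "e = (d / (2 * s powr (1 - p))) powr (1 / p)"
  have d: "0 < d" using s by (simp add: d_def)
  have "e powr p = d / (2 * s powr (1 - p))" using d s assms by (simp add: e_def powr_powr)
  then have "s powr (1 - p) * e powr p = d / 2" using s by simp
  then have "(1 - s) powr (1 - p) * t + s powr (1 - p) * e powr p < u" using d by (simp add: d_def)
  moreover have "0 < e" using d s by (simp add: e_def)
  ultimately show ?thesis using s that by blast
qed

text \<open>The case s = 1/2 of \<open>powr_add_le\<close>. It serves the moment bounds, where the
  size of the constant does not matter.\<close>

lemma dist_powr_triangle: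
  fixes x y z :: "'a::metric_space"
  assumes "1 \<le> p"
  shows "dist x z powr p \<le> 2 powr (p - 1) * (dist x y powr p + dist y z powr p)"
proof -
  have half: "(1 / 2 :: real) powr (1 - p) = 2 powr (p - 1)"
    by (simp add: powr_divide powr_minus_divide[symmetric])
  have "dist x z powr p \<le> (dist x y + dist y z) powr p"
    using assms by (intro powr_mono2 dist_triangle) auto
  also have "\<dots> \<le> (1 - 1 / 2) powr (1 - p) * dist x y powr p + (1 / 2) powr (1 - p) * dist y z powr p"
    using assms by (intro powr_add_le) auto
  finally show ?thesis by (simp add: half algebra_simps)
qed

section \<open>Gluing along a countable partition of the common factor\<close>

lemma nn_integral_split_countable:
  fixes \<kappa> :: "'w \<Rightarrow> nat"
  assumes [measurable]: "f \<in> borel_measurable M" "\<kappa> \<in> measurable M (count_space UNIV)"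
  shows "(\<integral>\<^sup>+w. f w \<partial>M) = (\<Sum>k. \<integral>\<^sup>+w. f w * indicator {w \<in> space M. \<kappa> w = k} w \<partial>M)"
proof -
  have "(\<integral>\<^sup>+w. f w \<partial>M) = (\<integral>\<^sup>+w. (\<Sum>k. f w * indicator {w \<in> space M. \<kappa> w = k} w) \<partial>M)"
  proof (rule nn_integral_cong)
    fix w assume w: "w \<in> space M"
    have "disjoint_family (\<lambda>k. {w \<in> space M. \<kappa> w = k})" by (auto simp: disjoint_family_on_def)
    from suminf_cmult_indicator[OF this, of w "\<kappa> w" "\<lambda>_. f w"] w
    show "f w = (\<Sum>k. f w * indicator {w \<in> space M. \<kappa> w = k} w)" by simp
  qed
  also have "\<dots> = (\<Sum>k. \<integral>\<^sup>+w. f w * indicator {w \<in> space M. \<kappa> w = k} w \<partial>M)"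
    by (rule nn_integral_suminf) measurable
  finally show ?thesis .
qed

text \<open>The fibres of \<open>\<kappa>\<close> form a countable Borel partition of E into cells
  of diameter at most 2 * e, with \<open>q k\<close> as the centre of cell \<open>k\<close>.\<close>

lemma countable_net_index:
  assumes e: "0 < e"
  obtains \<kappa> :: "'a::{metric_space, second_countable_topology} \<Rightarrow> nat" and q :: "nat \<Rightarrow> 'a"
  where "\<kappa> \<in> measurable borel (count_space UNIV)" "\<And>y. dist y (q (\<kappa> y)) < e"
proof -
  obtain q :: "nat \<Rightarrow> 'a" where q: "\<And>x e. 0 < e \<Longrightarrow> \<exists>k. dist x (q k) < e"
    using dense_sequence by blast
  have "(\<lambda>y. LEAST k. dist y (q k) < e) \<in> measurable borel (count_space UNIV)" by measurable
  moreover have "dist y (q (LEAST k. dist y (q k) < e)) < e" for y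
    by (rule LeastI_ex[OF q[OF e]])
  ultimately show ?thesis by (rule that)
qed

text \<open>Gluing without disintegration: conditioning on the countably many cells of a partition is
  elementary, and costs only an error of the order of the diameter of the cells.\<close>

lemma approximate_gluing:
  fixes \<mu> :: "nat \<Rightarrow> 'a::polish_space measure"
  assumes sets_\<nu>: "sets \<nu> = sets borel" and prob_\<nu>: "prob_space \<nu>"
    and \<pi>: "\<And>i. i < J \<Longrightarrow> \<pi> i \<in> couplings2 (\<mu> i) \<nu>" and e: "0 < e" and p: "1 \<le> p"
  obtains \<theta> where "\<theta> \<in> couplings (Suc J) (\<mu>(J := \<nu>))"
    "\<And>i. i < J \<Longrightarrow> (\<integral>\<^sup>+x. ennreal (dist (x i) (x J) powr p) \<partial>\<theta>)
      \<le> (\<integral>\<^sup>+z. ennreal ((dist (fst z) (snd z) + e) powr p) \<partial>\<pi> i)"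
proof -
  have sets_\<pi>: "sets (\<pi> i) = sets borel" and prob_\<pi>: "prob_space (\<pi> i)"
    and fst_\<pi>: "distr (\<pi> i) borel fst = \<mu> i" and snd_\<pi>: "distr (\<pi> i) borel snd = \<nu>" if "i < J" for i
    using \<pi>[OF that] by (auto simp: couplings2_def)
  interpret \<nu>: prob_space \<nu> by (rule prob_\<nu>)
  \<comment> \<open>Half of \<open>e\<close> pays for replacing the common coordinate by the centre
    of its cell, the other half for the way back under \<open>\<pi> i\<close>.\<close>
  obtain \<kappa> :: "'a \<Rightarrow> nat" and q where \<kappa>: "\<kappa> \<in> measurable borel (count_space UNIV)"
    and q: "\<And>y. dist y (q (\<kappa> y)) < e / 2"
    using countable_net_index[of "e / 2"] e by auto
  have fst_m: "fst \<in> measurable (\<pi> i) borel" and snd_m: "snd \<in> measurable (\<pi> i) borel" if "i < J" for i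
    unfolding measurable_cong_sets[OF sets_\<pi>[OF that] refl]
    by (simp_all flip: borel_prod)
  have \<kappa>\<nu>: "\<kappa> \<in> measurable \<nu> (count_space UNIV)"
    using \<kappa> by (simp add: measurable_cong_sets[OF sets_\<nu> refl])
  have \<kappa>\<pi>: "(\<lambda>w. \<kappa> (snd w)) \<in> measurable (\<pi> i) (count_space UNIV)" if "i < J" for i
    by (rule measurable_compose[OF snd_m[OF that] \<kappa>])
  define A where "A i k = {w \<in> space (\<pi> i). \<kappa> (snd w) = k}" for i k
  \<comment> \<open>first coordinate of \<open>\<pi> i\<close>, conditioned on the second one lying in cell \<open>k\<close>\<close>
  define Q where "Q i k = (if emeasure (\<pi> i) (A i k) = 0 then return borel undefined
    else distr (uniform_measure (\<pi> i) (A i k)) borel fst)" for i k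
  have A: "A i k \<in> sets (\<pi> i)" if "i < J" for i k
  proof -
    have "(\<lambda>w. \<kappa> (snd w)) -` {k} \<inter> space (\<pi> i) \<in> sets (\<pi> i)"
      by (rule measurable_sets[OF \<kappa>\<pi>[OF that]]) simp
    also have "(\<lambda>w. \<kappa> (snd w)) -` {k} \<inter> space (\<pi> i) = A i k" by (auto simp: A_def)
    finally show ?thesis .
  qed
  have sets_Q[measurable_cong]: "sets (Q i k) = sets borel" for i k by (simp add: Q_def)
  have prob_Q: "prob_space (Q i k)" if i: "i < J" for i k
  proof (cases "emeasure (\<pi> i) (A i k) = 0")
    case True
    then show ?thesis by (simp add: Q_def prob_space_return)
  next
    case False
    have "emeasure (\<pi> i) (A i k) \<noteq> \<infinity>"
      using prob_space.emeasure_le_1[OF prob_\<pi>[OF i], of "A i k"] by (auto simp: top_unique)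
    with False have "prob_space (uniform_measure (\<pi> i) (A i k))" by (rule prob_space_uniform_measure)
    moreover have "fst \<in> measurable (uniform_measure (\<pi> i) (A i k)) borel" using fst_m[OF i] by simp
    ultimately show ?thesis
      unfolding Q_def using False by (simp add: prob_space.prob_space_distr)
  qed
  \<comment> \<open>Multiplying by the mass of the cell covers null cells as well, where the choice
    of \<open>Q i k\<close> is arbitrary.\<close>
  have Q_mass: "(\<integral>\<^sup>+x. f x \<partial>Q i k) * emeasure (\<pi> i) (A i k) = (\<integral>\<^sup>+w. f (fst w) * indicator (A i k) w \<partial>\<pi> i)"
    if i: "i < J" and f: "f \<in> borel_measurable borel" for f :: "'a \<Rightarrow> ennreal" and i k
  proof (cases "emeasure (\<pi> i) (A i k) = 0")
    case True
    have "AE w in \<pi> i. w \<notin> A i k" using True A[OF i] by (intro AE_not_in) (auto simp: null_sets_def)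
    then have "(\<integral>\<^sup>+w. f (fst w) * indicator (A i k) w \<partial>\<pi> i) = (\<integral>\<^sup>+w. 0 \<partial>\<pi> i)"
      by (intro nn_integral_cong_AE) (auto elim!: eventually_mono)
    with True show ?thesis by simp
  next
    case False
    have fin: "emeasure (\<pi> i) (A i k) \<noteq> \<top>"
      using prob_space.emeasure_le_1[OF prob_\<pi>[OF i], of "A i k"] by (auto simp: top_unique)
    have ff: "(\<lambda>w. f (fst w)) \<in> borel_measurable (\<pi> i)" by (rule measurable_compose[OF fst_m[OF i] f])
    have "(\<integral>\<^sup>+x. f x \<partial>Q i k) = (\<integral>\<^sup>+w. f (fst w) \<partial>uniform_measure (\<pi> i) (A i k))"
      unfolding Q_def using False f fst_m[OF i] by (simp add: nn_integral_distr)
    also have "\<dots> = (\<integral>\<^sup>+w. f (fst w) * indicator (A i k) w \<partial>\<pi> i) / emeasure (\<pi> i) (A i k)"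
      by (rule nn_integral_uniform_measure[OF ff A[OF i]])
    finally show ?thesis using False fin by (simp add: ennreal_divide_times less_top[symmetric])
  qed
  \<comment> \<open>Independent variables distributed as \<open>Q i k\<close>, one for each marginal \<open>i\<close> and each cell \<open>k\<close>;
    the coordinate \<open>x i\<close> reads off the one indexed by the cell of the common coordinate \<open>x J\<close>.\<close>
  define I where "I = {..<J} \<times> (UNIV :: nat set)"
  define M where "M = PiM I (\<lambda>(i, k). Q i k)"
  have M: "prob_space M" unfolding M_def by (intro prob_space_PiM) (auto simp: I_def prob_Q)
  interpret M: prob_space M by (rule M)
  let ?P = "\<nu> \<Otimes>\<^sub>M M"
  interpret P: pair_prob_space \<nu> M ..
  have z: "(\<lambda>z. z (i, k)) \<in> measurable M borel" if "i < J" for i k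
    unfolding M_def measurable_cong_sets[OF refl sets_Q[symmetric, of i k]]
    using measurable_component_singleton[of "(i, k)" I "\<lambda>(i, k). Q i k"] that by (simp add: I_def)
  have z\<kappa>: "(\<lambda>w. snd w (i, \<kappa> (fst w))) \<in> measurable ?P borel" if "i < J" for i
  proof (rule measurable_compose_countable[of "\<lambda>k w. snd w (i, k)"])
    show "(\<lambda>w. snd w (i, k)) \<in> measurable ?P borel" for k
      by (rule measurable_compose[OF measurable_snd z[OF that]])
    show "(\<lambda>w. \<kappa> (fst w)) \<in> measurable ?P (count_space UNIV)"
      by (rule measurable_compose[OF measurable_fst \<kappa>\<nu>])
  qed
  \<comment> \<open>The pair formed by the cell of the common coordinate and the \<open>i\<close>-th
    coordinate has the same law as under \<open>\<pi> i\<close>: the cells have equal probabilities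
    because both second coordinates have law \<open>\<nu>\<close>, and given cell \<open>k\<close>
    the \<open>i\<close>-th coordinate has law \<open>Q i k\<close>. Only the position inside the
    cell is decoupled.\<close>
  have key: "(\<integral>\<^sup>+w. F (\<kappa> (fst w)) (snd w (i, \<kappa> (fst w))) \<partial>?P) = (\<integral>\<^sup>+w. F (\<kappa> (snd w)) (fst w) \<partial>\<pi> i)"
    if i: "i < J" and F: "\<And>k. F k \<in> borel_measurable borel" for F :: "nat \<Rightarrow> 'a \<Rightarrow> ennreal" and i
  proof -
    define h where "h k = (\<integral>\<^sup>+x. F k x \<partial>Q i k)" for k
    have meas: "(\<lambda>w. F (\<kappa> (fst w)) (snd w (i, \<kappa> (fst w)))) \<in> borel_measurable ?P"
    proof (rule measurable_compose_countable[of "\<lambda>k w. F k (snd w (i, \<kappa> (fst w)))"])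
      show "(\<lambda>w. F k (snd w (i, \<kappa> (fst w)))) \<in> borel_measurable ?P" for k
        by (rule measurable_compose[OF z\<kappa>[OF i] F])
      show "(\<lambda>w. \<kappa> (fst w)) \<in> measurable ?P (count_space UNIV)"
        by (rule measurable_compose[OF measurable_fst \<kappa>\<nu>])
    qed
    have h_z: "(\<integral>\<^sup>+z. F k (z (i, k)) \<partial>M) = h k" for k
    proof -
      have "distr M (Q i k) (\<lambda>z. z (i, k)) = Q i k"
        using distr_PiM_component[of I "\<lambda>(i, k). Q i k" "(i, k)"] prob_Q i by (auto simp: M_def I_def)
      moreover have "(\<integral>\<^sup>+x. F k x \<partial>distr M (Q i k) (\<lambda>z. z (i, k))) = (\<integral>\<^sup>+z. F k (z (i, k)) \<partial>M)"
        using z[OF i, of k] F by (intro nn_integral_distr) (simp_all add: measurable_cong_sets[OF refl sets_Q] measurable_cong_sets[OF sets_Q refl])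
      ultimately show ?thesis by (simp add: h_def)
    qed
    have h_meas: "(\<lambda>w. h (\<kappa> (snd w))) \<in> borel_measurable (\<pi> i)"
      using measurable_compose[OF \<kappa>\<pi>[OF i], of h] by simp
    have F_meas: "(\<lambda>w. F (\<kappa> (snd w)) (fst w)) \<in> borel_measurable (\<pi> i)"
      by (rule measurable_compose_countable[of "\<lambda>k w. F k (fst w)", OF measurable_compose[OF fst_m[OF i] F] \<kappa>\<pi>[OF i]])
    have "(\<integral>\<^sup>+w. F (\<kappa> (fst w)) (snd w (i, \<kappa> (fst w))) \<partial>?P)
        = (\<integral>\<^sup>+y. \<integral>\<^sup>+z. F (\<kappa> y) (z (i, \<kappa> y)) \<partial>M \<partial>\<nu>)"
      using M.nn_integral_fst[OF meas] by simp
    also have "\<dots> = (\<integral>\<^sup>+y. h (\<kappa> y) \<partial>\<nu>)" by (simp add: h_z)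
    also have "\<dots> = (\<integral>\<^sup>+y. h (\<kappa> y) \<partial>distr (\<pi> i) borel snd)" by (simp add: snd_\<pi>[OF i])
    also have "\<dots> = (\<integral>\<^sup>+w. h (\<kappa> (snd w)) \<partial>\<pi> i)"
      by (rule nn_integral_distr[OF snd_m[OF i]]) (use measurable_compose[OF \<kappa>, of h] in simp)
    also have "\<dots> = (\<Sum>k. \<integral>\<^sup>+w. h (\<kappa> (snd w)) * indicator (A i k) w \<partial>\<pi> i)"
      unfolding A_def by (rule nn_integral_split_countable[OF h_meas \<kappa>\<pi>[OF i]])
    also have "\<dots> = (\<Sum>k. \<integral>\<^sup>+w. F (\<kappa> (snd w)) (fst w) * indicator (A i k) w \<partial>\<pi> i)"
    proof (rule suminf_cong)
      fix k
      have "(\<integral>\<^sup>+w. h (\<kappa> (snd w)) * indicator (A i k) w \<partial>\<pi> i) = (\<integral>\<^sup>+w. h k * indicator (A i k) w \<partial>\<pi> i)"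
        by (intro nn_integral_cong) (auto simp: indicator_def A_def)
      also have "\<dots> = h k * emeasure (\<pi> i) (A i k)" using A[OF i] by (rule nn_integral_cmult_indicator)
      also have "\<dots> = (\<integral>\<^sup>+w. F k (fst w) * indicator (A i k) w \<partial>\<pi> i)" unfolding h_def by (rule Q_mass[OF i F])
      also have "\<dots> = (\<integral>\<^sup>+w. F (\<kappa> (snd w)) (fst w) * indicator (A i k) w \<partial>\<pi> i)"
        by (intro nn_integral_cong) (auto simp: indicator_def A_def)
      finally show "(\<integral>\<^sup>+w. h (\<kappa> (snd w)) * indicator (A i k) w \<partial>\<pi> i) =
        (\<integral>\<^sup>+w. F (\<kappa> (snd w)) (fst w) * indicator (A i k) w \<partial>\<pi> i)" .
    qed
    also have "\<dots> = (\<integral>\<^sup>+w. F (\<kappa> (snd w)) (fst w) \<partial>\<pi> i)"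
      unfolding A_def by (rule nn_integral_split_countable[OF F_meas \<kappa>\<pi>[OF i], symmetric])
    finally show ?thesis .
  qed
  define X where "X w = (\<lambda>i\<in>{..<Suc J}. if i < J then snd w (i, \<kappa> (fst w)) else fst w)" for w :: "'a \<times> (nat \<times> nat \<Rightarrow> 'a)"
  have fst_P: "fst \<in> measurable ?P borel"
    unfolding measurable_cong_sets[OF refl sets_\<nu>[symmetric]] by (rule measurable_fst)
  have X: "X \<in> measurable ?P (EJ (Suc J))"
    unfolding X_def
  proof (rule measurable_restrict)
    fix i show "(\<lambda>w. if i < J then snd w (i, \<kappa> (fst w)) else fst w) \<in> measurable ?P borel"
      using z\<kappa>[of i] fst_P by (cases "i < J") auto
  qed
  define \<theta> where "\<theta> = distr ?P (EJ (Suc J)) X"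
  have \<theta>_i: "distr \<theta> borel (\<lambda>x. x i) = distr ?P borel (\<lambda>w. X w i)" if "i < Suc J" for i
    unfolding \<theta>_def using that by (subst distr_distr[OF _ X]) (auto simp: comp_def)
  have "\<theta> \<in> couplings (Suc J) (\<mu>(J := \<nu>))"
    unfolding couplings_def
  proof (intro CollectI conjI allI impI)
    show "prob_space \<theta>" unfolding \<theta>_def by (rule P.prob_space_distr[OF X])
    fix i assume i: "i < Suc J"
    show "distr \<theta> borel (\<lambda>x. x i) = (\<mu>(J := \<nu>)) i"
    proof (cases "i = J")
      case True
      have "distr ?P borel (\<lambda>w. X w J) = distr ?P \<nu> fst"
        using sets_\<nu> by (intro distr_cong) (auto simp: X_def)
      also have "\<dots> = \<nu>" by (rule M.distr_pair_fst)
      finally show ?thesis using True i by (simp add: \<theta>_i)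
    next
      case False
      with i have iJ: "i < J" by simp
      have "distr ?P borel (\<lambda>w. X w i) = \<mu> i"
      proof (rule measure_eqI)
        fix B assume "B \<in> sets (distr ?P borel (\<lambda>w. X w i))"
        then have B: "B \<in> sets borel" by simp
        have "emeasure (distr ?P borel (\<lambda>w. X w i)) B = (\<integral>\<^sup>+x. indicator B x \<partial>distr ?P borel (\<lambda>w. X w i))"
          using B by simp
        also have "\<dots> = (\<integral>\<^sup>+w. indicator B (snd w (i, \<kappa> (fst w))) \<partial>?P)"
          using B z\<kappa>[OF iJ] i iJ by (subst nn_integral_distr) (auto simp: X_def cong: measurable_cong)
        also have "\<dots> = (\<integral>\<^sup>+w. indicator B (fst w) \<partial>\<pi> i)"
          using key[OF iJ, of "\<lambda>_. indicator B"] B by simp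
        also have "\<dots> = (\<integral>\<^sup>+x. indicator B x \<partial>distr (\<pi> i) borel fst)"
          using B by (intro nn_integral_distr[OF fst_m[OF iJ], symmetric]) simp
        also have "\<dots> = emeasure (\<mu> i) B" using B by (simp add: fst_\<pi>[OF iJ, symmetric])
        finally show "emeasure (distr ?P borel (\<lambda>w. X w i)) B = emeasure (\<mu> i) B" .
      qed (use fst_\<pi>[OF iJ] in \<open>auto simp: sets_distr[of "\<pi> i" borel fst, symmetric]\<close>)
      then show ?thesis using i False by (simp add: \<theta>_i)
    qed
  qed (simp add: \<theta>_def)
  moreover have "(\<integral>\<^sup>+x. ennreal (dist (x i) (x J) powr p) \<partial>\<theta>)
      \<le> (\<integral>\<^sup>+z. ennreal ((dist (fst z) (snd z) + e) powr p) \<partial>\<pi> i)" if i: "i < J" for i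
  proof -
    have xi: "(\<lambda>x. x j) \<in> measurable (EJ (Suc J)) (borel :: 'a measure)" if "j < Suc J" for j
      using that by (intro measurable_component_singleton) simp
    have "(\<integral>\<^sup>+x. ennreal (dist (x i) (x J) powr p) \<partial>\<theta>) = (\<integral>\<^sup>+w. ennreal (dist (X w i) (X w J) powr p) \<partial>?P)"
      unfolding \<theta>_def using xi[of i] xi[of J] i by (intro nn_integral_distr[OF X]) simp
    \<comment> \<open>With the centre of the cell in place of the common coordinate, the integrand
      depends only on the cell and on coordinate \<open>i\<close>, as \<open>key\<close>
      demands.\<close>
    also have "\<dots> \<le> (\<integral>\<^sup>+w. ennreal ((dist (snd w (i, \<kappa> (fst w))) (q (\<kappa> (fst w))) + e / 2) powr p) \<partial>?P)"
    proof (intro nn_integral_mono ennreal_leI powr_mono2)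
      fix w
      show "dist (X w i) (X w J) \<le> dist (snd w (i, \<kappa> (fst w))) (q (\<kappa> (fst w))) + e / 2"
        using q[of "fst w"] dist_triangle2[of "snd w (i, \<kappa> (fst w))" "fst w" "q (\<kappa> (fst w))"] i
        by (simp add: X_def)
    qed (use p in auto)
    also have "\<dots> = (\<integral>\<^sup>+w. ennreal ((dist (fst w) (q (\<kappa> (snd w))) + e / 2) powr p) \<partial>\<pi> i)"
      by (rule key[OF i, of "\<lambda>k x. ennreal ((dist x (q k) + e / 2) powr p)"]) measurable
    also have "\<dots> \<le> (\<integral>\<^sup>+z. ennreal ((dist (fst z) (snd z) + e) powr p) \<partial>\<pi> i)"
    proof (intro nn_integral_mono ennreal_leI powr_mono2)
      fix w :: "'a \<times> 'a"
      show "dist (fst w) (q (\<kappa> (snd w))) + e / 2 \<le> dist (fst w) (snd w) + e"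
        using q[of "snd w"] dist_triangle[of "fst w" "q (\<kappa> (snd w))" "snd w"] by simp
    qed (use p e in auto)
    finally show ?thesis .
  qed
  ultimately show ?thesis by (rule that)
qed

section \<open>Barycenters\<close>

text \<open>If \<open>c y \<le> t\<close>, the assumed bound with the constants of
  \<open>powr_perturbation\<close> would give \<open>c x < c x\<close>. The term
  \<open>2 * e\<close> leaves room for distances both of whose endpoints move by
  \<open>e\<close>.\<close>

lemma lsc_on_productI_powr:
  fixes c :: "(nat \<Rightarrow> 'a::metric_space) \<Rightarrow> real"
  assumes p: "1 \<le> p" and nonneg: "\<And>x. 0 \<le> c x"
    and le: "\<And>x y s e. 0 < s \<Longrightarrow> s < 1 \<Longrightarrow> 0 < e \<Longrightarrow> (\<And>i. i < K \<Longrightarrow> dist (x i) (y i) < e) \<Longrightarrow>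
      c x \<le> (1 - s) powr (1 - p) * c y + s powr (1 - p) * (2 * e) powr p"
  shows "lsc_on_product K c"
  unfolding lsc_on_product_def
proof (intro ballI allI impI)
  fix x t assume t: "t < c x"
  obtain s e where s: "0 < s" "s < 1" "0 < e" "(1 - s) powr (1 - p) * t + s powr (1 - p) * e powr p < c x"
    using powr_perturbation[OF t p] by blast
  have "t < c y" if "\<forall>i<K. dist (x i) (y i) < e / 2" for y
  proof (rule ccontr)
    assume "\<not> t < c y"
    then have "(1 - s) powr (1 - p) * c y \<le> (1 - s) powr (1 - p) * t"
      by (intro mult_left_mono) auto
    with le[of s "e / 2" x y] s that show False by simp
  qed
  then show "\<exists>e>0. \<forall>y\<in>space (EJ K). (\<forall>i<K. dist (x i) (y i) < e) \<longrightarrow> t < c y"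
    using s(3) by (intro exI[of _ "e / 2"]) auto
qed

section \<open>Weighted sums of p-th powers and their infimum over E\<close>

locale weighted_powers =
  fixes p :: real and J :: nat and lam :: "nat \<Rightarrow> real"
  assumes p: "1 \<le> p" and J: "1 \<le> J"
    and lam_pos: "\<And>i. i < J \<Longrightarrow> 0 < lam i" and lam_sum: "(\<Sum>i<J. lam i) = 1"
begin

definition point_cost :: "(nat \<Rightarrow> 'a::metric_space) \<Rightarrow> 'a \<Rightarrow> real" where
  "point_cost xs z = (\<Sum>i<J. lam i * dist (xs i) z powr p)"

lemma bary_cost_eq: "bary_cost J p lam xs = (INF z. point_cost xs z)"
  by (simp add: bary_cost_def point_cost_def)

lemma is_pointwise_bary_iff: "is_pointwise_bary J p lam xs y \<longleftrightarrow> (\<forall>z. point_cost xs y \<le> point_cost xs z)"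
  by (simp add: is_pointwise_bary_def point_cost_def)

lemma point_cost_nonneg: "0 \<le> point_cost xs z"
  unfolding point_cost_def using lam_pos by (intro sum_nonneg) (auto simp: less_imp_le)

lemma point_cost_cong: "(\<And>i. i < J \<Longrightarrow> xs i = ys i) \<Longrightarrow> point_cost xs z = point_cost ys z"
  unfolding point_cost_def by (intro sum.cong) auto

lemma bary_cost_le: "bary_cost J p lam xs \<le> point_cost xs z"
  unfolding bary_cost_eq
  by (intro cINF_lower bdd_belowI[of _ 0]) (auto simp: point_cost_nonneg)

lemma bary_cost_greatest: "(\<And>z. b \<le> point_cost xs z) \<Longrightarrow> b \<le> bary_cost J p lam xs"
  unfolding bary_cost_eq by (intro cINF_greatest) auto

lemma bary_cost_nonneg: "0 \<le> bary_cost J p lam xs"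
  by (intro bary_cost_greatest point_cost_nonneg)

lemma bary_cost_cong: "(\<And>i. i < J \<Longrightarrow> xs i = ys i) \<Longrightarrow> bary_cost J p lam xs = bary_cost J p lam ys"
  unfolding bary_cost_eq using point_cost_cong[of xs ys] by simp

lemma point_cost_pointwise_bary:
  "is_pointwise_bary J p lam xs y \<Longrightarrow> point_cost xs y = bary_cost J p lam xs"
  unfolding is_pointwise_bary_iff by (intro antisym bary_cost_greatest bary_cost_le) auto

lemma ennreal_point_cost:
  "ennreal (point_cost xs z) = (\<Sum>i<J. ennreal (lam i) * ennreal (dist (xs i) z powr p))"
proof -
  have "(\<Sum>i<J. ennreal (lam i) * ennreal (dist (xs i) z powr p)) = (\<Sum>i<J. ennreal (lam i * dist (xs i) z powr p))"
    using lam_pos by (intro sum.cong) (auto simp: ennreal_mult' less_imp_le)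
  also have "\<dots> = ennreal (point_cost xs z)"
    unfolding point_cost_def using lam_pos by (intro sum_ennreal) (auto simp: less_imp_le)
  finally show ?thesis ..
qed

text \<open>Since the weights sum to 1, averaging leaves the error term of
  \<open>powr_add_le\<close> unchanged.\<close>

lemma point_cost_perturb:
  assumes s: "0 < s" "s < 1" and e: "0 < e" and d: "\<And>i. i < J \<Longrightarrow> dist (x i) z \<le> dist (y i) z' + e"
  shows "point_cost x z \<le> (1 - s) powr (1 - p) * point_cost y z' + s powr (1 - p) * e powr p"
proof -
  let ?a = "(1 - s) powr (1 - p)" and ?b = "s powr (1 - p) * e powr p"
  have "point_cost x z \<le> (\<Sum>i<J. lam i * (?a * dist (y i) z' powr p + ?b))"
    unfolding point_cost_def
  proof (intro sum_mono mult_left_mono)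
    fix i assume i: "i \<in> {..<J}"
    have "dist (x i) z powr p \<le> (dist (y i) z' + e) powr p"
      using p d i by (intro powr_mono2) auto
    also have "\<dots> \<le> ?a * dist (y i) z' powr p + ?b" using s e p by (intro powr_add_le) auto
    finally show "dist (x i) z powr p \<le> ?a * dist (y i) z' powr p + ?b" .
  qed (use lam_pos in \<open>auto simp: less_imp_le\<close>)
  also have "\<dots> = ?a * point_cost y z' + (\<Sum>i<J. lam i) * ?b"
    by (simp add: point_cost_def sum_distrib_left sum_distrib_right sum.distrib algebra_simps)
  finally show ?thesis by (simp add: lam_sum)
qed

text \<open>An infimum of continuous functions is in general only upper semicontinuous. Here the
  constants of the perturbation bound do not depend on the competitor \<open>z\<close>, so the bound
  survives the infimum.\<close>

lemma lsc_bary_cost: "lsc_on_product J (bary_cost J p lam)"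
proof (rule lsc_on_productI_powr[OF p bary_cost_nonneg])
  fix x y :: "nat \<Rightarrow> 'a" and s e :: real
  assume s: "0 < s" "s < 1" and e: "0 < e" and d: "\<And>i. i < J \<Longrightarrow> dist (x i) (y i) < e"
  let ?a = "(1 - s) powr (1 - p)" and ?b = "s powr (1 - p) * (2 * e) powr p"
  have "(bary_cost J p lam x - ?b) / ?a \<le> bary_cost J p lam y"
  proof (rule bary_cost_greatest)
    fix z
    have "dist (x i) z \<le> dist (y i) z + 2 * e" if "i < J" for i
      using d[OF that] dist_triangle[of "x i" z "y i"] e by simp
    then have "point_cost x z \<le> ?a * point_cost y z + ?b"
      using s e by (intro point_cost_perturb) auto
    then have "bary_cost J p lam x - ?b \<le> point_cost y z * ?a"
      using bary_cost_le[of x z] by (simp add: mult.commute)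
    then show "(bary_cost J p lam x - ?b) / ?a \<le> point_cost y z" using s by (simp add: divide_le_eq)
  qed
  then show "bary_cost J p lam x \<le> ?a * bary_cost J p lam y + ?b"
    using s by (simp add: divide_le_eq mult.commute)
qed

lemma lsc_point_cost_last: "lsc_on_product (Suc J) (\<lambda>x. point_cost x (x J))"
proof (rule lsc_on_productI_powr[OF p point_cost_nonneg])
  fix x y :: "nat \<Rightarrow> 'a" and s e :: real
  assume s: "0 < s" "s < 1" and e: "0 < e" and d: "\<And>i. i < Suc J \<Longrightarrow> dist (x i) (y i) < e"
  have "dist (x i) (x J) \<le> dist (y i) (y J) + 2 * e" if "i < J" for i
    using d[of i] d[of J] that dist_triangle[of "x i" "x J" "y i"] dist_triangle[of "y i" "x J" "y J"]
    by (simp add: dist_commute)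
  then show "point_cost x (x J) \<le> (1 - s) powr (1 - p) * point_cost y (y J) + s powr (1 - p) * (2 * e) powr p"
    using s e by (intro point_cost_perturb) auto
qed

section \<open>Measurability, moments and finiteness of costs\<close>

lemma component_measurable: "i < K \<Longrightarrow> (\<lambda>x. x i) \<in> measurable (EJ K) (borel :: 'a::topological_space measure)"
  by (intro measurable_component_singleton) simp

lemma bary_cost_measurable:
  "(\<lambda>x. ennreal (bary_cost J p lam x)) \<in> borel_measurable (EJ J :: (nat \<Rightarrow> 'a::polish_space) measure)"
  by (intro lsc_on_product_measurable lsc_bary_cost bary_cost_nonneg)

lemma dist_powr_measurable:
  "(\<lambda>y. ennreal (dist y (x :: 'a::{metric_space, second_countable_topology}) powr p)) \<in> borel_measurable borel"
  by measurable

text \<open>\<open>Wp_space\<close> provides some base point; the triangle inequality for p-th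
  powers moves it to any other.\<close>

lemma Wp_space_moment:
  fixes M :: "'a::{metric_space, second_countable_topology} measure"
  assumes "M \<in> Wp_space p"
  shows "(\<integral>\<^sup>+y. ennreal (dist y x powr p) \<partial>M) < \<infinity>"
proof -
  from assms obtain x0 where sets: "sets M = sets borel" and M: "prob_space M"
    and x0: "(\<integral>\<^sup>+y. ennreal (dist y x0 powr p) \<partial>M) < \<infinity>" by (auto simp: Wp_space_def)
  interpret prob_space M by fact
  have m: "(\<lambda>y. ennreal (dist y x0 powr p)) \<in> borel_measurable M"
    unfolding measurable_cong_sets[OF sets refl] by (rule dist_powr_measurable)
  let ?C = "2 powr (p - 1) :: real"
  have "(\<integral>\<^sup>+y. ennreal (dist y x powr p) \<partial>M) \<le> (\<integral>\<^sup>+y. ennreal ?C * (ennreal (dist y x0 powr p) + ennreal (dist x0 x powr p)) \<partial>M)"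
    by (intro nn_integral_mono) (simp flip: ennreal_mult' ennreal_plus add: ennreal_leI dist_powr_triangle[OF p])
  also have "\<dots> = ennreal ?C * ((\<integral>\<^sup>+y. ennreal (dist y x0 powr p) \<partial>M) + ennreal (dist x0 x powr p))"
    using m by (simp add: nn_integral_cmult nn_integral_add emeasure_space_1)
  also have "\<dots> < \<infinity>" using x0 by (simp add: ennreal_mult_less_top)
  finally show ?thesis .
qed

lemma nn_integral_point_cost:
  fixes f :: "'w \<Rightarrow> nat \<Rightarrow> 'a::{metric_space, second_countable_topology}"
  assumes "\<And>i. i < J \<Longrightarrow> (\<lambda>w. f w i) \<in> borel_measurable M" "g \<in> borel_measurable M"
  shows "(\<integral>\<^sup>+w. ennreal (point_cost (f w) (g w)) \<partial>M) =
    (\<Sum>i<J. ennreal (lam i) * (\<integral>\<^sup>+w. ennreal (dist (f w i) (g w) powr p) \<partial>M))"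
proof -
  have m: "(\<lambda>w. ennreal (dist (f w i) (g w) powr p)) \<in> borel_measurable M" if "i < J" for i
    using assms(1)[OF that] assms(2) by measurable
  have "(\<integral>\<^sup>+w. ennreal (point_cost (f w) (g w)) \<partial>M) =
      (\<Sum>i<J. \<integral>\<^sup>+w. ennreal (lam i) * ennreal (dist (f w i) (g w) powr p) \<partial>M)"
    unfolding ennreal_point_cost using m by (intro nn_integral_sum) auto
  also have "\<dots> = (\<Sum>i<J. ennreal (lam i) * (\<integral>\<^sup>+w. ennreal (dist (f w i) (g w) powr p) \<partial>M))"
    using m by (intro sum.cong nn_integral_cmult) auto
  finally show ?thesis .
qed

lemma MM_cost_finite:
  fixes \<mu> :: "nat \<Rightarrow> 'a::polish_space measure"
  assumes mu: "\<And>i. i < J \<Longrightarrow> \<mu> i \<in> Wp_space p" and \<gamma>: "\<gamma> \<in> couplings J \<mu>"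
  shows "MM_cost J p lam \<gamma> < \<infinity>"
proof -
  have sets: "sets \<gamma> = sets (EJ J)" and marg: "\<And>i. i < J \<Longrightarrow> distr \<gamma> borel (\<lambda>x. x i) = \<mu> i"
    using \<gamma> by (auto simp: couplings_def)
  have comp: "(\<lambda>x. x i) \<in> measurable \<gamma> borel" if "i < J" for i
    unfolding measurable_cong_sets[OF sets refl] by (rule component_measurable[OF that])
  \<comment> \<open>Any fixed point of E can serve as the competitor in the infimum.\<close>
  let ?o = "undefined :: 'a"
  have "MM_cost J p lam \<gamma> \<le> (\<integral>\<^sup>+x. ennreal (point_cost x ?o) \<partial>\<gamma>)"
    unfolding MM_cost_def by (intro nn_integral_mono ennreal_leI bary_cost_le)
  also have "\<dots> = (\<Sum>i<J. ennreal (lam i) * (\<integral>\<^sup>+x. ennreal (dist (x i) ?o powr p) \<partial>\<gamma>))"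
    using comp by (intro nn_integral_point_cost) auto
  also have "\<dots> = (\<Sum>i<J. ennreal (lam i) * (\<integral>\<^sup>+y. ennreal (dist y ?o powr p) \<partial>\<mu> i))"
    using comp by (intro sum.cong) (auto simp: marg[symmetric] nn_integral_distr)
  also have "\<dots> < \<infinity>"
    using Wp_space_moment[OF mu] by (auto simp: ennreal_mult_less_top)
  finally show ?thesis .
qed

text \<open>Coordinate 0 alone controls the moment: \<open>lam 0 * dist (x 0) (T x) powr p\<close>
  is at most the pointwise optimal cost, whose integral is finite, and \<open>x 0\<close> has law
  \<open>\<mu> 0\<close>, which has a finite moment.\<close>

lemma pushforward_in_Wp_space:
  fixes \<mu> :: "nat \<Rightarrow> 'a::polish_space measure"
  assumes mu: "\<And>i. i < J \<Longrightarrow> \<mu> i \<in> Wp_space p" and \<gamma>: "\<gamma> \<in> couplings J \<mu>"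
    and T: "T \<in> measurable (EJ J) borel" "\<And>x. x \<in> space (EJ J) \<Longrightarrow> is_pointwise_bary J p lam x (T x)"
  shows "distr \<gamma> borel T \<in> Wp_space p"
proof -
  have sets: "sets \<gamma> = sets (EJ J)" and prob: "prob_space \<gamma>" and marg: "\<And>i. i < J \<Longrightarrow> distr \<gamma> borel (\<lambda>x. x i) = \<mu> i"
    using \<gamma> by (auto simp: couplings_def)
  have space: "space \<gamma> = space (EJ J)" by (rule sets_eq_imp_space_eq[OF sets])
  have [measurable]: "T \<in> measurable \<gamma> borel" using T(1) by (simp add: measurable_cong_sets[OF sets refl])
  have [measurable]: "(\<lambda>x. x 0) \<in> measurable \<gamma> borel"
    unfolding measurable_cong_sets[OF sets refl] using J by (intro component_measurable) simp
  have bary_m: "(\<lambda>x. ennreal (bary_cost J p lam x)) \<in> borel_measurable \<gamma>"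
    unfolding measurable_cong_sets[OF sets refl] by (rule bary_cost_measurable)
  have dist_m: "(\<lambda>x. ennreal (dist (x 0) (undefined :: 'a) powr p)) \<in> borel_measurable \<gamma>"
    by (rule measurable_compose[OF \<open>(\<lambda>x. x 0) \<in> measurable \<gamma> borel\<close> dist_powr_measurable])
  have l0: "0 < lam 0" using lam_pos J by simp
  let ?o = "undefined :: 'a" and ?C = "2 powr (p - 1) :: real"
  have "(\<integral>\<^sup>+y. ennreal (dist y ?o powr p) \<partial>distr \<gamma> borel T) = (\<integral>\<^sup>+x. ennreal (dist (T x) ?o powr p) \<partial>\<gamma>)"
    by (intro nn_integral_distr) (simp_all add: dist_powr_measurable)
  also have "\<dots> \<le> (\<integral>\<^sup>+x. ennreal (?C / lam 0) * ennreal (bary_cost J p lam x) + ennreal ?C * ennreal (dist (x 0) ?o powr p) \<partial>\<gamma>)"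
  proof (rule nn_integral_mono)
    fix x assume "x \<in> space \<gamma>"
    then have "point_cost x (T x) = bary_cost J p lam x" using T(2) space by (intro point_cost_pointwise_bary) simp
    moreover have "lam 0 * dist (x 0) (T x) powr p \<le> point_cost x (T x)"
      unfolding point_cost_def using J lam_pos
      by (intro member_le_sum[where f="\<lambda>i. lam i * dist (x i) (T x) powr p"]) (auto simp: less_imp_le)
    ultimately have "dist (x 0) (T x) powr p \<le> bary_cost J p lam x / lam 0" using l0 by (simp add: le_divide_eq mult.commute)
    then have "?C * dist (T x) (x 0) powr p \<le> ?C * (bary_cost J p lam x / lam 0)"
      by (intro mult_left_mono) (simp_all add: dist_commute)
    with dist_powr_triangle[OF p, of "T x" ?o "x 0"]
    have "dist (T x) ?o powr p \<le> ?C / lam 0 * bary_cost J p lam x + ?C * dist (x 0) ?o powr p"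
      by (simp add: algebra_simps)
    then show "ennreal (dist (T x) ?o powr p) \<le>
        ennreal (?C / lam 0) * ennreal (bary_cost J p lam x) + ennreal ?C * ennreal (dist (x 0) ?o powr p)"
      using l0 bary_cost_nonneg[of x] by (simp flip: ennreal_mult' ennreal_plus add: ennreal_leI)
  qed
  also have "\<dots> = ennreal (?C / lam 0) * MM_cost J p lam \<gamma> + ennreal ?C * (\<integral>\<^sup>+x. ennreal (dist (x 0) ?o powr p) \<partial>\<gamma>)"
    using bary_m dist_m by (simp add: MM_cost_def nn_integral_add nn_integral_cmult)
  also have "(\<integral>\<^sup>+x. ennreal (dist (x 0) ?o powr p) \<partial>\<gamma>) = (\<integral>\<^sup>+y. ennreal (dist y ?o powr p) \<partial>\<mu> 0)"
    using J dist_powr_measurable by (subst marg[of 0, symmetric]) (simp_all add: nn_integral_distr)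
  also have "ennreal (?C / lam 0) * MM_cost J p lam \<gamma> + ennreal ?C * \<dots> < \<infinity>"
    using MM_cost_finite[of \<mu>, OF mu \<gamma>] Wp_space_moment[OF mu[of 0], of ?o] J
    by (simp add: ennreal_mult_less_top)
  finally show ?thesis
    unfolding Wp_space_def using prob_space.prob_space_distr[OF prob \<open>T \<in> measurable \<gamma> borel\<close>] by auto
qed

section \<open>Comparison of the barycenter functional with the multi-marginal cost\<close>

lemma bary_fun_pushforward_le:
  fixes \<mu> :: "nat \<Rightarrow> 'a::polish_space measure"
  assumes \<gamma>: "\<gamma> \<in> couplings J \<mu>"
    and T: "T \<in> measurable (EJ J) borel" "\<And>x. x \<in> space (EJ J) \<Longrightarrow> is_pointwise_bary J p lam x (T x)"
  shows "bary_fun J p lam \<mu> (distr \<gamma> borel T) \<le> MM_cost J p lam \<gamma>"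
proof -
  have sets: "sets \<gamma> = sets (EJ J)" and prob: "prob_space \<gamma>" and marg: "\<And>i. i < J \<Longrightarrow> distr \<gamma> borel (\<lambda>x. x i) = \<mu> i"
    using \<gamma> by (auto simp: couplings_def)
  have space: "space \<gamma> = space (EJ J)" by (rule sets_eq_imp_space_eq[OF sets])
  have T\<gamma>: "T \<in> measurable \<gamma> borel" using T(1) by (simp add: measurable_cong_sets[OF sets refl])
  have comp: "(\<lambda>x. x i) \<in> measurable \<gamma> borel" if "i < J" for i
    unfolding measurable_cong_sets[OF sets refl] by (rule component_measurable[OF that])
  have "Wpp p (\<mu> i) (distr \<gamma> borel T) \<le> (\<integral>\<^sup>+x. ennreal (dist (x i) (T x) powr p) \<partial>\<gamma>)" if i: "i < J" for i
  proof -
    let ?\<pi> = "distr \<gamma> borel (\<lambda>x. (x i, T x))"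
    have pair: "(\<lambda>x. (x i, T x)) \<in> measurable \<gamma> borel"
      by (rule borel_measurable_Pair[OF comp[OF i] T\<gamma>])
    have fs: "fst \<in> measurable (borel :: ('a \<times> 'a) measure) borel" "snd \<in> measurable (borel :: ('a \<times> 'a) measure) borel"
      by (simp_all flip: borel_prod)
    have "?\<pi> \<in> couplings2 (\<mu> i) (distr \<gamma> borel T)"
      unfolding couplings2_def
      using prob_space.prob_space_distr[OF prob pair] marg[OF i]
      by (simp add: distr_distr[OF fs(1) pair] distr_distr[OF fs(2) pair] comp_def)
    then have "Wpp p (\<mu> i) (distr \<gamma> borel T) \<le> (\<integral>\<^sup>+z. ennreal (dist (fst z) (snd z) powr p) \<partial>?\<pi>)"
      unfolding Wpp_def by (rule INF_lower)
    also have "\<dots> = (\<integral>\<^sup>+x. ennreal (dist (x i) (T x) powr p) \<partial>\<gamma>)"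
      by (subst nn_integral_distr[OF pair]) (use fs in simp_all)
    finally show ?thesis .
  qed
  then have "bary_fun J p lam \<mu> (distr \<gamma> borel T) \<le> (\<Sum>i<J. ennreal (lam i) * (\<integral>\<^sup>+x. ennreal (dist (x i) (T x) powr p) \<partial>\<gamma>))"
    unfolding bary_fun_def by (intro sum_mono mult_left_mono) auto
  also have "\<dots> = (\<integral>\<^sup>+x. ennreal (point_cost x (T x)) \<partial>\<gamma>)"
    using comp T\<gamma> by (intro nn_integral_point_cost[symmetric])
  also have "\<dots> = MM_cost J p lam \<gamma>"
    unfolding MM_cost_def using T(2) space by (intro nn_integral_cong) (simp add: point_cost_pointwise_bary)
  finally show ?thesis .
qed

lemma near_optimal_gluing:
  fixes \<mu> :: "nat \<Rightarrow> 'a::polish_space measure"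
  assumes \<nu>: "sets \<nu> = sets borel" "prob_space \<nu>"
    and fin: "bary_fun J p lam \<mu> \<nu> < \<infinity>" and \<delta>: "0 < \<delta>"
  obtains \<theta> where "\<theta> \<in> couplings (Suc J) (\<mu>(J := \<nu>))"
    "(\<integral>\<^sup>+x. ennreal (point_cost x (x J)) \<partial>\<theta>) \<le> bary_fun J p lam \<mu> \<nu> + ennreal \<delta>"
proof -
  let ?W = "\<lambda>i. Wpp p (\<mu> i) \<nu>"
  have W_fin: "?W i < \<top>" if "i < J" for i
  proof -
    have "ennreal (lam i) * ?W i < \<top>"
      using fin that by (simp add: bary_fun_def)
    then show ?thesis using lam_pos[OF that] by (auto simp: ennreal_mult_less_top)
  qed
  define w where "w i = enn2real (?W i)" for i
  have W: "?W i = ennreal (w i)" if "i < J" for i using W_fin[OF that] by (simp add: w_def)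
  have w_nonneg: "0 \<le> w i" for i by (simp add: w_def)
  define B where "B = (\<Sum>i<J. lam i * w i)"
  have B: "bary_fun J p lam \<mu> \<nu> = ennreal B"
  proof -
    have "bary_fun J p lam \<mu> \<nu> = (\<Sum>i<J. ennreal (lam i * w i))"
      unfolding bary_fun_def using W w_nonneg lam_pos by (intro sum.cong) (auto simp: ennreal_mult less_imp_le)
    also have "\<dots> = ennreal B"
      unfolding B_def using lam_pos w_nonneg by (intro sum_ennreal) (auto simp: less_imp_le)
    finally show ?thesis .
  qed
  have B_nonneg: "0 \<le> B" unfolding B_def using lam_pos w_nonneg by (intro sum_nonneg) (auto simp: less_imp_le)
  \<comment> \<open>Half of \<open>\<delta>\<close> is spent on plans \<open>\<pi> i\<close> that
    miss their infima by less than \<open>\<delta>\<close> / 2, which the weights average to at most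
    \<open>\<delta>\<close> / 2; the other half pays for the gluing error.\<close>
  obtain s e where s: "0 < s" "s < 1" and e: "0 < e"
    and se: "(1 - s) powr (1 - p) * (B + \<delta> / 2) + s powr (1 - p) * e powr p < B + \<delta>"
    using powr_perturbation[of "B + \<delta> / 2" "B + \<delta>" p] p \<delta> by auto
  let ?a = "(1 - s) powr (1 - p)" and ?b = "s powr (1 - p) * e powr p"
  have "\<forall>i\<in>{..<J}. \<exists>\<pi>. \<pi> \<in> couplings2 (\<mu> i) \<nu> \<and>
      (\<integral>\<^sup>+z. ennreal (dist (fst z) (snd z) powr p) \<partial>\<pi>) < ennreal (w i + \<delta> / 2)"
  proof
    fix i assume "i \<in> {..<J}"
    then have "?W i < ennreal (w i + \<delta> / 2)" using W[of i] w_nonneg \<delta> by (simp add: ennreal_less_iff)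
    then show "\<exists>\<pi>. \<pi> \<in> couplings2 (\<mu> i) \<nu> \<and>
        (\<integral>\<^sup>+z. ennreal (dist (fst z) (snd z) powr p) \<partial>\<pi>) < ennreal (w i + \<delta> / 2)"
      by (simp add: Wpp_def INF_less_iff Bex_def)
  qed
  from bchoice[OF this] obtain \<pi> where \<pi>: "\<And>i. i < J \<Longrightarrow> \<pi> i \<in> couplings2 (\<mu> i) \<nu>"
    and \<pi>_cost: "\<And>i. i < J \<Longrightarrow> (\<integral>\<^sup>+z. ennreal (dist (fst z) (snd z) powr p) \<partial>\<pi> i) < ennreal (w i + \<delta> / 2)"
    by auto
  obtain \<theta> where \<theta>: "\<theta> \<in> couplings (Suc J) (\<mu>(J := \<nu>))"
    and \<theta>_cost: "\<And>i. i < J \<Longrightarrow> (\<integral>\<^sup>+x. ennreal (dist (x i) (x J) powr p) \<partial>\<theta>)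
      \<le> (\<integral>\<^sup>+z. ennreal ((dist (fst z) (snd z) + e) powr p) \<partial>\<pi> i)"
    by (rule approximate_gluing[where \<mu>=\<mu> and \<pi>=\<pi>, OF \<nu> \<pi> e p]) blast+
  have sets_\<theta>: "sets \<theta> = sets (EJ (Suc J))" using \<theta> by (simp add: couplings_def)
  have comp: "(\<lambda>x. x i) \<in> measurable \<theta> borel" if "i < Suc J" for i
    unfolding measurable_cong_sets[OF sets_\<theta> refl] by (rule component_measurable[OF that])
  have i_cost: "(\<integral>\<^sup>+x. ennreal (dist (x i) (x J) powr p) \<partial>\<theta>) \<le> ennreal (?a * (w i + \<delta> / 2) + ?b)" if i: "i < J" for i
  proof -
    have sets: "sets (\<pi> i) = sets borel" and "prob_space (\<pi> i)" using \<pi>[OF i] by (auto simp: couplings2_def)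
    interpret prob_space "\<pi> i" by fact
    have m: "(\<lambda>z. ennreal (dist (fst z) (snd z) powr p)) \<in> borel_measurable (\<pi> i)"
      unfolding measurable_cong_sets[OF sets refl] by (simp flip: borel_prod)
    have "(\<integral>\<^sup>+z. ennreal ((dist (fst z) (snd z) + e) powr p) \<partial>\<pi> i)
        \<le> (\<integral>\<^sup>+z. ennreal ?a * ennreal (dist (fst z) (snd z) powr p) + ennreal ?b \<partial>\<pi> i)"
    proof (rule nn_integral_mono)
      fix z :: "'a \<times> 'a"
      have "(dist (fst z) (snd z) + e) powr p \<le> ?a * dist (fst z) (snd z) powr p + ?b"
        using s e p by (intro powr_add_le) auto
      then show "ennreal ((dist (fst z) (snd z) + e) powr p) \<le> ennreal ?a * ennreal (dist (fst z) (snd z) powr p) + ennreal ?b"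
        by (simp flip: ennreal_mult' ennreal_plus add: ennreal_leI)
    qed
    also have "\<dots> = ennreal ?a * (\<integral>\<^sup>+z. ennreal (dist (fst z) (snd z) powr p) \<partial>\<pi> i) + ennreal ?b"
      using m by (simp add: nn_integral_add nn_integral_cmult emeasure_space_1)
    also have "\<dots> \<le> ennreal ?a * ennreal (w i + \<delta> / 2) + ennreal ?b"
      using \<pi>_cost[OF i] by (intro add_right_mono mult_left_mono) auto
    also have "\<dots> = ennreal (?a * (w i + \<delta> / 2) + ?b)"
      using w_nonneg[of i] \<delta> by (simp flip: ennreal_mult' ennreal_plus)
    finally show ?thesis using \<theta>_cost[OF i] by (rule order_trans[rotated])
  qed
  have "(\<integral>\<^sup>+x. ennreal (point_cost x (x J)) \<partial>\<theta>) = (\<Sum>i<J. ennreal (lam i) * (\<integral>\<^sup>+x. ennreal (dist (x i) (x J) powr p) \<partial>\<theta>))"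
    using comp by (intro nn_integral_point_cost) auto
  also have "\<dots> \<le> (\<Sum>i<J. ennreal (lam i) * ennreal (?a * (w i + \<delta> / 2) + ?b))"
    using i_cost by (intro sum_mono mult_left_mono) auto
  also have "\<dots> = ennreal (\<Sum>i<J. lam i * (?a * (w i + \<delta> / 2) + ?b))"
    using lam_pos w_nonneg \<delta> by (subst sum_ennreal[symmetric]) (auto simp: ennreal_mult' less_imp_le)
  also have "(\<Sum>i<J. lam i * (?a * (w i + \<delta> / 2) + ?b)) = ?a * B + (\<Sum>i<J. lam i) * (?a * (\<delta> / 2)) + (\<Sum>i<J. lam i) * ?b"
    unfolding B_def by (simp add: sum_distrib_left sum_distrib_right sum.distrib algebra_simps)
  also have "\<dots> = ?a * (B + \<delta> / 2) + ?b" by (simp add: lam_sum algebra_simps)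
  also have "ennreal \<dots> \<le> ennreal (B + \<delta>)" using se by (intro ennreal_leI) simp
  also have "\<dots> = bary_fun J p lam \<mu> \<nu> + ennreal \<delta>" using B B_nonneg \<delta> by simp
  finally show ?thesis using that[OF \<theta>] by simp
qed

lemma restrict_measurable: "(\<lambda>x. restrict x {..<J}) \<in> measurable (EJ (Suc J)) (EJ J)"
  by (rule measurable_restrict_subset) auto

lemma restrict_coupling:
  fixes \<mu> :: "nat \<Rightarrow> 'a::polish_space measure"
  assumes \<theta>: "\<theta> \<in> couplings (Suc J) (\<mu>(J := \<nu>))"
  shows "distr \<theta> (EJ J) (\<lambda>x. restrict x {..<J}) \<in> couplings J \<mu>"
    and "MM_cost J p lam (distr \<theta> (EJ J) (\<lambda>x. restrict x {..<J})) = (\<integral>\<^sup>+x. ennreal (bary_cost J p lam x) \<partial>\<theta>)"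
proof -
  have sets: "sets \<theta> = sets (EJ (Suc J))" and prob: "prob_space \<theta>"
    and marg: "\<And>i. i < Suc J \<Longrightarrow> distr \<theta> borel (\<lambda>x. x i) = (\<mu>(J := \<nu>)) i"
    using \<theta> by (auto simp: couplings_def)
  have R: "(\<lambda>x. restrict x {..<J}) \<in> measurable \<theta> (EJ J)"
    using restrict_measurable by (simp add: measurable_cong_sets[OF sets refl])
  show "distr \<theta> (EJ J) (\<lambda>x. restrict x {..<J}) \<in> couplings J \<mu>"
    unfolding couplings_def
  proof (intro CollectI conjI allI impI)
    show "prob_space (distr \<theta> (EJ J) (\<lambda>x. restrict x {..<J}))" by (rule prob_space.prob_space_distr[OF prob R])
    fix i assume i: "i < J"
    show "distr (distr \<theta> (EJ J) (\<lambda>x. restrict x {..<J})) borel (\<lambda>x. x i) = \<mu> i"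
      using i marg[of i] by (simp add: distr_distr[OF component_measurable R] comp_def)
  qed simp
  have "MM_cost J p lam (distr \<theta> (EJ J) (\<lambda>x. restrict x {..<J})) = (\<integral>\<^sup>+x. ennreal (bary_cost J p lam (restrict x {..<J})) \<partial>\<theta>)"
    unfolding MM_cost_def by (rule nn_integral_distr[OF R]) (use bary_cost_measurable in simp)
  also have "\<dots> = (\<integral>\<^sup>+x. ennreal (bary_cost J p lam x) \<partial>\<theta>)"
    by (intro nn_integral_cong arg_cong[where f=ennreal] bary_cost_cong) simp
  finally show "MM_cost J p lam (distr \<theta> (EJ J) (\<lambda>x. restrict x {..<J})) = (\<integral>\<^sup>+x. ennreal (bary_cost J p lam x) \<partial>\<theta>)" .
qed

lemma MM_minimum_le_bary_fun:
  fixes \<mu> :: "nat \<Rightarrow> 'a::polish_space measure"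
  assumes \<nu>: "\<nu> \<in> Wp_space p" and \<gamma>: "is_MM_minimizer J p lam \<mu> \<gamma>"
  shows "MM_cost J p lam \<gamma> \<le> bary_fun J p lam \<mu> \<nu>"
proof (cases "bary_fun J p lam \<mu> \<nu> < \<infinity>")
  case True
  show ?thesis
  proof (rule ennreal_le_epsilon)
    fix \<delta> :: real assume "0 < \<delta>"
    with True \<nu> obtain \<theta> where \<theta>: "\<theta> \<in> couplings (Suc J) (\<mu>(J := \<nu>))"
      "(\<integral>\<^sup>+x. ennreal (point_cost x (x J)) \<partial>\<theta>) \<le> bary_fun J p lam \<mu> \<nu> + ennreal \<delta>"
      using near_optimal_gluing[of \<nu> \<mu> \<delta>] by (auto simp: Wp_space_def)
    have "MM_cost J p lam \<gamma> \<le> (\<integral>\<^sup>+x. ennreal (bary_cost J p lam x) \<partial>\<theta>)"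
      using \<gamma> restrict_coupling[OF \<theta>(1)] unfolding is_MM_minimizer_def by metis
    also have "\<dots> \<le> (\<integral>\<^sup>+x. ennreal (point_cost x (x J)) \<partial>\<theta>)"
      by (intro nn_integral_mono ennreal_leI bary_cost_le)
    finally show "MM_cost J p lam \<gamma> \<le> bary_fun J p lam \<mu> \<nu> + ennreal \<delta>" using \<theta>(2) by simp
  qed
qed (simp add: top.not_eq_extremum[symmetric])

text \<open>The near optimal gluings for different \<open>\<delta>\<close> are couplings of the same
  J + 1 marginals, so one minimizer among these couplings is as good as all of them.\<close>

lemma optimal_gluing:
  fixes \<mu> :: "nat \<Rightarrow> 'a::polish_space measure"
  assumes \<nu>: "sets \<nu> = sets borel" "prob_space \<nu>" and fin: "bary_fun J p lam \<mu> \<nu> < \<infinity>"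
  obtains \<theta> where "\<theta> \<in> couplings (Suc J) (\<mu>(J := \<nu>))"
    "(\<integral>\<^sup>+x. ennreal (point_cost x (x J)) \<partial>\<theta>) \<le> bary_fun J p lam \<mu> \<nu>"
proof -
  have ne: "couplings (Suc J) (\<mu>(J := \<nu>)) \<noteq> {}"
    using near_optimal_gluing[OF \<nu> fin, of 1] by auto
  obtain \<theta> where \<theta>: "\<theta> \<in> couplings (Suc J) (\<mu>(J := \<nu>))"
    "\<And>\<theta>'. \<theta>' \<in> couplings (Suc J) (\<mu>(J := \<nu>)) \<Longrightarrow>
      (\<integral>\<^sup>+x. ennreal (point_cost x (x J)) \<partial>\<theta>) \<le> (\<integral>\<^sup>+x. ennreal (point_cost x (x J)) \<partial>\<theta>')"
    by (rule couplings_attain_minimum[OF ne lsc_point_cost_last point_cost_nonneg]) blast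
  have "(\<integral>\<^sup>+x. ennreal (point_cost x (x J)) \<partial>\<theta>) \<le> bary_fun J p lam \<mu> \<nu>"
  proof (rule ennreal_le_epsilon)
    fix \<delta> :: real assume "0 < \<delta>"
    from near_optimal_gluing[OF \<nu> fin this] obtain \<theta>' where "\<theta>' \<in> couplings (Suc J) (\<mu>(J := \<nu>))"
      "(\<integral>\<^sup>+x. ennreal (point_cost x (x J)) \<partial>\<theta>') \<le> bary_fun J p lam \<mu> \<nu> + ennreal \<delta>" .
    with \<theta>(2) show "(\<integral>\<^sup>+x. ennreal (point_cost x (x J)) \<partial>\<theta>) \<le> bary_fun J p lam \<mu> \<nu> + ennreal \<delta>"
      by (meson order_trans)
  qed
  with \<theta>(1) show ?thesis by (rule that)
qed

section \<open>Existence of minimizers and their correspondence with barycenters\<close>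

lemma MM_minimizer_exists:
  fixes \<mu> :: "nat \<Rightarrow> 'a::polish_space measure"
  assumes mu: "\<And>i. i < J \<Longrightarrow> \<mu> i \<in> Wp_space p"
  shows "\<exists>\<gamma>. is_MM_minimizer J p lam \<mu> \<gamma>"
proof -
  have "couplings J \<mu> \<noteq> {}" using mu by (intro couplings_nonempty) (auto simp: Wp_space_def)
  then obtain \<gamma> where "\<gamma> \<in> couplings J \<mu>" "\<And>\<gamma>'. \<gamma>' \<in> couplings J \<mu> \<Longrightarrow>
      (\<integral>\<^sup>+x. ennreal (bary_cost J p lam x) \<partial>\<gamma>) \<le> (\<integral>\<^sup>+x. ennreal (bary_cost J p lam x) \<partial>\<gamma>')"
    by (rule couplings_attain_minimum[OF _ lsc_bary_cost bary_cost_nonneg]) blast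
  then show ?thesis unfolding is_MM_minimizer_def MM_cost_def by auto
qed

lemma MM_minimizer_imp_barycenter:
  fixes \<mu> :: "nat \<Rightarrow> 'a::polish_space measure"
  assumes mu: "\<And>i. i < J \<Longrightarrow> \<mu> i \<in> Wp_space p"
    and T: "T \<in> measurable (EJ J) borel" "\<And>x. x \<in> space (EJ J) \<Longrightarrow> is_pointwise_bary J p lam x (T x)"
    and \<gamma>: "is_MM_minimizer J p lam \<mu> \<gamma>"
  shows "is_barycenter J p lam \<mu> (distr \<gamma> borel T)"
proof -
  have c: "\<gamma> \<in> couplings J \<mu>" using \<gamma> by (simp add: is_MM_minimizer_def)
  show ?thesis
    unfolding is_barycenter_def
  proof (intro conjI ballI)
    show "distr \<gamma> borel T \<in> Wp_space p" by (rule pushforward_in_Wp_space[of \<mu>, OF mu c T])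
    fix \<nu> :: "'a measure" assume "\<nu> \<in> Wp_space p"
    show "bary_fun J p lam \<mu> (distr \<gamma> borel T) \<le> bary_fun J p lam \<mu> \<nu>"
      using bary_fun_pushforward_le[OF c T] MM_minimum_le_bary_fun[OF \<open>\<nu> \<in> Wp_space p\<close> \<gamma>]
      by (rule order_trans)
  qed
qed

lemma barycenter_imp_MM_minimizer:
  fixes \<mu> :: "nat \<Rightarrow> 'a::polish_space measure"
  assumes mu: "\<And>i. i < J \<Longrightarrow> \<mu> i \<in> Wp_space p"
    and T: "T \<in> measurable (EJ J) borel" "\<And>x. x \<in> space (EJ J) \<Longrightarrow> is_pointwise_bary J p lam x (T x)"
    and unique: "\<And>x :: nat \<Rightarrow> 'a. x \<in> space (EJ J) \<Longrightarrow> \<exists>!y. is_pointwise_bary J p lam x y"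
    and \<nu>: "is_barycenter J p lam \<mu> \<nu>"
  obtains \<gamma> where "is_MM_minimizer J p lam \<mu> \<gamma>" "\<nu> = distr \<gamma> borel T"
proof -
  obtain \<gamma>0 where \<gamma>0: "is_MM_minimizer J p lam \<mu> \<gamma>0" using MM_minimizer_exists[of \<mu>, OF mu] ..
  then have c0: "\<gamma>0 \<in> couplings J \<mu>" by (simp add: is_MM_minimizer_def)
  have \<nu>_Wp: "\<nu> \<in> Wp_space p" using \<nu> by (simp add: is_barycenter_def)
  then have \<nu>': "sets \<nu> = sets borel" "prob_space \<nu>" by (auto simp: Wp_space_def)
  have "bary_fun J p lam \<mu> \<nu> \<le> bary_fun J p lam \<mu> (distr \<gamma>0 borel T)"
    using \<nu> pushforward_in_Wp_space[of \<mu>, OF mu c0 T] by (simp add: is_barycenter_def)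
  also have "\<dots> \<le> MM_cost J p lam \<gamma>0" by (rule bary_fun_pushforward_le[OF c0 T])
  finally have le0: "bary_fun J p lam \<mu> \<nu> \<le> MM_cost J p lam \<gamma>0" .
  have fin0: "MM_cost J p lam \<gamma>0 < \<infinity>" by (rule MM_cost_finite[of \<mu>, OF mu c0])
  obtain \<theta> where \<theta>: "\<theta> \<in> couplings (Suc J) (\<mu>(J := \<nu>))"
    and "(\<integral>\<^sup>+x. ennreal (point_cost x (x J)) \<partial>\<theta>) \<le> bary_fun J p lam \<mu> \<nu>"
    by (rule optimal_gluing[OF \<nu>' le_less_trans[OF le0 fin0]])
  with le0 have \<theta>_le: "(\<integral>\<^sup>+x. ennreal (point_cost x (x J)) \<partial>\<theta>) \<le> MM_cost J p lam \<gamma>0" by simp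
  have sets: "sets \<theta> = sets (EJ (Suc J))" and marg: "distr \<theta> borel (\<lambda>x. x J) = \<nu>"
    using \<theta> by (auto simp: couplings_def)
  have space: "space \<theta> = space (EJ (Suc J))" by (rule sets_eq_imp_space_eq[OF sets])
  define \<gamma> where "\<gamma> = distr \<theta> (EJ J) (\<lambda>x. restrict x {..<J})"
  have \<gamma>: "\<gamma> \<in> couplings J \<mu>" and \<gamma>_cost: "MM_cost J p lam \<gamma> = (\<integral>\<^sup>+x. ennreal (bary_cost J p lam x) \<partial>\<theta>)"
    unfolding \<gamma>_def by (rule restrict_coupling[OF \<theta>])+
  have R: "(\<lambda>x. restrict x {..<J}) \<in> measurable \<theta> (EJ J)"
    using restrict_measurable by (simp add: measurable_cong_sets[OF sets refl])
  have "(\<integral>\<^sup>+x. ennreal (bary_cost J p lam x) \<partial>\<theta>) \<le> (\<integral>\<^sup>+x. ennreal (point_cost x (x J)) \<partial>\<theta>)"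
    by (intro nn_integral_mono ennreal_leI bary_cost_le)
  moreover have "MM_cost J p lam \<gamma>0 \<le> (\<integral>\<^sup>+x. ennreal (bary_cost J p lam x) \<partial>\<theta>)"
    using \<gamma>0 \<gamma> \<gamma>_cost unfolding is_MM_minimizer_def by metis
  \<comment> \<open>The inequalities close a circle through
    \<open>MM_cost J p lam \<gamma>0\<close>, so all of them are equalities. The common value is
    finite, as the subtraction of integrals below requires.\<close>
  ultimately have eq: "(\<integral>\<^sup>+x. ennreal (point_cost x (x J)) \<partial>\<theta>) = (\<integral>\<^sup>+x. ennreal (bary_cost J p lam x) \<partial>\<theta>)"
    and \<gamma>_le: "MM_cost J p lam \<gamma> \<le> MM_cost J p lam \<gamma>0"
    using \<theta>_le by (auto simp: \<gamma>_cost)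
  have min: "is_MM_minimizer J p lam \<mu> \<gamma>"
    using \<gamma> \<gamma>0 \<gamma>_le unfolding is_MM_minimizer_def by (meson order_trans)
  have m1: "(\<lambda>x. ennreal (point_cost x (x J))) \<in> borel_measurable \<theta>"
    unfolding measurable_cong_sets[OF sets refl]
    by (intro lsc_on_product_measurable lsc_point_cost_last point_cost_nonneg)
  have m2: "(\<lambda>x. ennreal (bary_cost J p lam x)) \<in> borel_measurable \<theta>"
  proof -
    have "(\<lambda>x. ennreal (bary_cost J p lam (restrict x {..<J}))) \<in> borel_measurable \<theta>"
      by (rule measurable_compose[OF R bary_cost_measurable])
    moreover have "bary_cost J p lam (restrict x {..<J}) = bary_cost J p lam x" for x :: "nat \<Rightarrow> 'a"
      by (rule bary_cost_cong) simp
    ultimately show ?thesis by simp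
  qed
  have "(\<integral>\<^sup>+x. ennreal (point_cost x (x J)) - ennreal (bary_cost J p lam x) \<partial>\<theta>) =
      (\<integral>\<^sup>+x. ennreal (point_cost x (x J)) \<partial>\<theta>) - (\<integral>\<^sup>+x. ennreal (bary_cost J p lam x) \<partial>\<theta>)"
    using m1 m2 \<gamma>_cost \<gamma>_le fin0 by (intro nn_integral_diff) (auto intro!: ennreal_leI bary_cost_le)
  also have "\<dots> = 0"
    using le_less_trans[OF \<gamma>_le fin0] by (simp add: eq \<gamma>_cost)
  finally have "AE x in \<theta>. ennreal (point_cost x (x J)) - ennreal (bary_cost J p lam x) = 0"
    using m1 m2 by (subst (asm) nn_integral_0_iff_AE) auto
  \<comment> \<open>Equality of the two costs means that \<open>x J\<close> attains the pointwise
    infimum. The restriction is taken because uniqueness and the minimality of \<open>T\<close> are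
    given on \<open>space (EJ J)\<close>.\<close>
  then have AE: "AE x in \<theta>. x J = T (restrict x {..<J})"
  proof (eventually_elim)
    fix x :: "nat \<Rightarrow> 'a" assume "ennreal (point_cost x (x J)) - ennreal (bary_cost J p lam x) = 0"
    then have "point_cost x (x J) \<le> bary_cost J p lam x"
      using bary_cost_nonneg[of x] point_cost_nonneg[of x "x J"] by (simp add: ennreal_minus ennreal_eq_0_iff)
    then have bary: "is_pointwise_bary J p lam (restrict x {..<J}) (x J)"
      unfolding is_pointwise_bary_iff
      using bary_cost_le[of x] point_cost_cong[of "restrict x {..<J}" x] by (auto intro: order_trans)
    have r: "restrict x {..<J} \<in> space (EJ J)" by (simp add: space_PiM)
    show "x J = T (restrict x {..<J})"
      by (rule trans[OF the1_equality[OF unique[OF r] bary, symmetric] the1_equality[OF unique[OF r] T(2)[OF r]]])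
  qed
  have "\<nu> = distr \<theta> borel (\<lambda>x. T (restrict x {..<J}))"
    unfolding marg[symmetric]
  proof (rule distr_cong_AE)
    show "(\<lambda>x. x J) \<in> measurable \<theta> borel"
      unfolding measurable_cong_sets[OF sets refl] by (rule component_measurable) simp
    show "(\<lambda>x. T (restrict x {..<J})) \<in> measurable \<theta> borel" by (rule measurable_compose[OF R T(1)])
  qed (use AE in auto)
  also have "\<dots> = distr \<gamma> borel T" unfolding \<gamma>_def by (simp add: distr_distr[OF T(1) R] comp_def)
  finally show ?thesis using that[OF min] by blast
qed

end

theorem mainTheorem8:
  fixes p :: real and J :: nat
    and \<mu> :: "nat \<Rightarrow> 'a::polish_space measure"
    and lam :: "nat \<Rightarrow> real"
  assumes geo: "geodesic_space TYPE('a)"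
    and p: "p \<ge> 1"
    and J: "J \<ge> 1"
    and mu: "\<forall>i<J. \<mu> i \<in> Wp_space p"
    and lam_pos: "\<forall>i<J. lam i > 0"
    and lam_sum: "(\<Sum>i<J. lam i) = 1"
  shows "(\<exists>\<gamma>. is_MM_minimizer J p lam \<mu> \<gamma>)
    \<and> (\<forall>T. T \<in> measurable (EJ J) (borel :: 'a measure)
          \<and> (\<forall>xs\<in>space (EJ J :: (nat \<Rightarrow> 'a) measure). is_pointwise_bary J p lam xs (T xs))
        \<longrightarrow> (\<forall>\<gamma>. is_MM_minimizer J p lam \<mu> \<gamma> \<longrightarrow> is_barycenter J p lam \<mu> (distr \<gamma> borel T))
          \<and> ((\<forall>xs\<in>space (EJ J :: (nat \<Rightarrow> 'a) measure). \<exists>!y. is_pointwise_bary J p lam xs y)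
              \<longrightarrow> (\<forall>\<nu>. is_barycenter J p lam \<mu> \<nu> \<longrightarrow>
                     (\<exists>\<gamma>. is_MM_minimizer J p lam \<mu> \<gamma> \<and> \<nu> = distr \<gamma> borel T))))"
proof -
  interpret weighted_powers p J lam
    using p J lam_pos lam_sum by unfold_locales auto
  have mu': "\<And>i. i < J \<Longrightarrow> \<mu> i \<in> Wp_space p" using mu by blast
  show ?thesis
  proof (intro conjI allI impI; (elim conjE)?)
    show "\<exists>\<gamma>. is_MM_minimizer J p lam \<mu> \<gamma>" by (rule MM_minimizer_exists[of \<mu>, OF mu'])
  next
    fix T :: "(nat \<Rightarrow> 'a) \<Rightarrow> 'a" and \<gamma>
    assume T: "T \<in> measurable (EJ J) borel"
      "\<forall>xs\<in>space (EJ J :: (nat \<Rightarrow> 'a) measure). is_pointwise_bary J p lam xs (T xs)"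
      and \<gamma>: "is_MM_minimizer J p lam \<mu> \<gamma>"
    show "is_barycenter J p lam \<mu> (distr \<gamma> borel T)"
      by (rule MM_minimizer_imp_barycenter[of \<mu>, OF mu' T(1) bspec[OF T(2)] \<gamma>])
  next
    fix T :: "(nat \<Rightarrow> 'a) \<Rightarrow> 'a" and \<nu>
    assume T: "T \<in> measurable (EJ J) borel"
      "\<forall>xs\<in>space (EJ J :: (nat \<Rightarrow> 'a) measure). is_pointwise_bary J p lam xs (T xs)"
      and unique: "\<forall>xs\<in>space (EJ J :: (nat \<Rightarrow> 'a) measure). \<exists>!y. is_pointwise_bary J p lam xs y"
      and \<nu>: "is_barycenter J p lam \<mu> \<nu>"
    obtain \<gamma> where "is_MM_minimizer J p lam \<mu> \<gamma>" "\<nu> = distr \<gamma> borel T"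
      by (rule barycenter_imp_MM_minimizer[of \<mu>, OF mu' T(1) bspec[OF T(2)] bspec[OF unique] \<nu>])
    then show "\<exists>\<gamma>. is_MM_minimizer J p lam \<mu> \<gamma> \<and> \<nu> = distr \<gamma> borel T" by blast
  qed
qed

end
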